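(* Let $V(p)=v$ be an infinitesimal translation of $\mathbb{R}^3$, with $v\in\mathbb{R}^3$ a unit length eigenvector of the rotational part of the monodromy $h=Ap+a$ (i.e. $Av=v$). Then the flux functional $E_V$ becomes $$E_{-1}=\tfrac12\int_I(\gamma\times d\gamma,v).$$ For a closed curve, $E_{-1}$ measures the signed enclosed area of the orthogonal projection of the curve $\gamma\in\mathcal{M}$ onto the plane $v^\perp$. The variational and symplectic gradients of $E_{-1}$ are given by $$G_{-1}=\gamma'\times v\qquad\text{and}\qquad Y_{-1}\equiv v\mod C^\infty(\mathcal{M},\mathbb{R})T .$$
   Context: Let $M\cong\mathbb{R}$ be an oriented 1-manifold with a fixed translation $\tau\in\mathrm{Diff}(M)$, $M/\tau\cong S^1$, and $I\subset M$ a fundamental domain. Let $h(p)=Ap+a$ with $A\in SO(3)$, and let $\mathcal{M}=\mathcal{M}_h$ be the manifold of smooth immersions $\gamma\colon M\to\mathbb{R}^3$ with $\gamma\circ\tau=h\circ\gamma$; $T_\gamma\mathcal{M}$ consists of smooth $\xi\colon M\to\mathbb{R}^3$ with $\xi\circ\tau=A\xi$. The origin of $\mathbb{R}^3$ is chosen on the axis $\mathbb{R}v$ of $h$, so $a\in\mathbb{R}v$. Let $dx$ be arclength of $\gamma$, $(\ )'$ the arclength derivative, $T=\gamma'$. $\langle\xi,\eta\rangle_\gamma=\int_I(\xi,\eta)dx$ and $\sigma_\gamma(\xi,\eta)=\int_I\det(T,\xi,\eta)dx=\langle T\times\xi,\eta\rangle$. The variational gradient $G_E$ of $E\colon\mathcal{M}\to\mathbb{R}$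 is defined by $\langle G_E,-\rangle=dE$, a symplectic gradient $Y_E$ by $\sigma(Y_E,-)=dE$; the latter is determined only up to adding function multiples of $T$, which is the meaning of "$\equiv\dots\mod C^\infty(\mathcal{M},\mathbb{R})T$". Flux functional: for a volume preserving vector field $V$ with an $h$-invariant primitive $\alpha_V$ of $i_V\det$ (i.e. $d\alpha_V=i_V\det$, $h^*\alpha_V=\alpha_V$), $E_V(\gamma)=\int_I\gamma^*\alpha_V$. Here, for $V=v$, the primitive chosen is $\alpha_V=\frac12\det(v,p,dp)$. *)

theory Defs
  imports "HOL-Complex_Analysis.Complex_Analysis"
begin

section \<open>Smooth maps\<close>

primrec C_on :: "nat \<Rightarrow> 'a::real_normed_vector set \<Rightarrow> ('a \<Rightarrow> 'b::real_normed_vector) \<Rightarrow> bool"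
  where
    "C_on 0 S f \<longleftrightarrow> continuous_on S f"
  | "C_on (Suc k) S f \<longleftrightarrow>
       (\<forall>x\<in>S. f differentiable (at x)) \<and> (\<forall>u. C_on k S (\<lambda>x. frechet_derivative f (at x) u))"

text \<open>Meant for open \<open>S\<close>.\<close>

definition smooth_on :: "'a::real_normed_vector set \<Rightarrow> ('a \<Rightarrow> 'b::real_normed_vector) \<Rightarrow> bool"
  where "smooth_on S f \<longleftrightarrow> (\<forall>k. C_on k S f)"


section \<open>The parameter manifold\<close>

text \<open>The oriented 1-manifold \<open>M\<close> is the real line. A diffeomorphism \<open>\<tau>\<close> of the line without
  fixed points is automatically increasing, acts properly discontinuously, and has a circle as
  quotient. It may move points in either direction, so the fundamental domain spanned by \<open>s\<close> and
  \<open>\<tau> s\<close> is written as a segment; integrals over it use the orientation of the line.\<close>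

definition translation_diffeo :: "(real \<Rightarrow> real) \<Rightarrow> bool"
  where "translation_diffeo \<tau> \<longleftrightarrow>
    bij \<tau> \<and> smooth_on UNIV \<tau> \<and> smooth_on UNIV (inv \<tau>) \<and> (\<forall>s. \<tau> s \<noteq> s)"

definition fundamental_domain :: "(real \<Rightarrow> real) \<Rightarrow> real set \<Rightarrow> bool"
  where "fundamental_domain \<tau> I \<longleftrightarrow> (\<exists>s. I = closed_segment s (\<tau> s))"


section \<open>Curves with monodromy, tangent vectors, and variations\<close>

definition monodromy :: "real^3^3 \<Rightarrow> real^3 \<Rightarrow> real^3 \<Rightarrow> real^3"
  where "monodromy A a p = A *v p + a"

definition curves :: "(real \<Rightarrow> real) \<Rightarrow> real^3^3 \<Rightarrow> real^3 \<Rightarrow> (real \<Rightarrow> real^3) set"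
  where "curves \<tau> A a =
    {\<gamma>. smooth_on UNIV \<gamma> \<and> (\<forall>s. vector_derivative \<gamma> (at s) \<noteq> 0) \<and>
        (\<forall>s. \<gamma> (\<tau> s) = monodromy A a (\<gamma> s))}"

text \<open>The tangent space of the space of curves is the same at every curve.\<close>

definition tangent_space :: "(real \<Rightarrow> real) \<Rightarrow> real^3^3 \<Rightarrow> (real \<Rightarrow> real^3) set"
  where "tangent_space \<tau> A = {\<xi>. smooth_on UNIV \<xi> \<and> (\<forall>s. \<xi> (\<tau> s) = A *v \<xi> s)}"

definition variation ::
  "(real \<Rightarrow> real) \<Rightarrow> real^3^3 \<Rightarrow> real^3 \<Rightarrow> (real \<Rightarrow> real^3) \<Rightarrow> (real \<Rightarrow> real^3) \<Rightarrow>
   (real \<Rightarrow> real \<Rightarrow> real^3) \<Rightarrow> bool"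
  where "variation \<tau> A a \<gamma> \<xi> \<Gamma> \<longleftrightarrow>
    (\<exists>\<epsilon>>0. smooth_on ({-\<epsilon><..<\<epsilon>} \<times> UNIV) (\<lambda>(t, s). \<Gamma> t s) \<and>
           (\<forall>t\<in>{-\<epsilon><..<\<epsilon>}. \<Gamma> t \<in> curves \<tau> A a)) \<and>
    \<Gamma> 0 = \<gamma> \<and>
    (\<forall>s. ((\<lambda>t. \<Gamma> t s) has_vector_derivative \<xi> s) (at 0))"

text \<open>\<open>D\<close> is the differential of \<open>E\<close> at \<open>\<gamma>\<close>, tested along all smooth curves through \<open>\<gamma>\<close> in the
  space of curves.\<close>

definition has_differential ::
  "(real \<Rightarrow> real) \<Rightarrow> real^3^3 \<Rightarrow> real^3 \<Rightarrow> ((real \<Rightarrow> real^3) \<Rightarrow> real) \<Rightarrow> (real \<Rightarrow> real^3) \<Rightarrow>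
   ((real \<Rightarrow> real^3) \<Rightarrow> real) \<Rightarrow> bool"
  where "has_differential \<tau> A a E \<gamma> D \<longleftrightarrow>
    (\<forall>\<xi>\<in>tangent_space \<tau> A. \<forall>\<Gamma>. variation \<tau> A a \<gamma> \<xi> \<Gamma> \<longrightarrow>
       ((\<lambda>t. E (\<Gamma> t)) has_real_derivative D \<xi>) (at 0))"


section \<open>Arclength, metric, presymplectic form, gradients\<close>

definition speed :: "(real \<Rightarrow> real^3) \<Rightarrow> real \<Rightarrow> real"
  where "speed \<gamma> s = norm (vector_derivative \<gamma> (at s))"

definition arclength_derivative :: "(real \<Rightarrow> real^3) \<Rightarrow> (real \<Rightarrow> real^3) \<Rightarrow> real \<Rightarrow> real^3"
  where "arclength_derivative \<gamma> \<xi> s = vector_derivative \<xi> (at s) /\<^sub>R speed \<gamma> s"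

definition unit_tangent :: "(real \<Rightarrow> real^3) \<Rightarrow> real \<Rightarrow> real^3"
  where "unit_tangent \<gamma> = arclength_derivative \<gamma> \<gamma>"

definition L2_metric ::
  "real set \<Rightarrow> (real \<Rightarrow> real^3) \<Rightarrow> (real \<Rightarrow> real^3) \<Rightarrow> (real \<Rightarrow> real^3) \<Rightarrow> real"
  where "L2_metric I \<gamma> \<xi> \<eta> = integral I (\<lambda>s. (\<xi> s \<bullet> \<eta> s) * speed \<gamma> s)"

definition presymplectic ::
  "real set \<Rightarrow> (real \<Rightarrow> real^3) \<Rightarrow> (real \<Rightarrow> real^3) \<Rightarrow> (real \<Rightarrow> real^3) \<Rightarrow> real"
  where "presymplectic I \<gamma> \<xi> \<eta> =
    integral I (\<lambda>s. det (vector [unit_tangent \<gamma> s, \<xi> s, \<eta> s]) * speed \<gamma> s)"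

definition variational_gradient ::
  "(real \<Rightarrow> real) \<Rightarrow> real set \<Rightarrow> real^3^3 \<Rightarrow> real^3 \<Rightarrow> ((real \<Rightarrow> real^3) \<Rightarrow> real) \<Rightarrow>
   ((real \<Rightarrow> real^3) \<Rightarrow> (real \<Rightarrow> real^3)) \<Rightarrow> bool"
  where "variational_gradient \<tau> I A a E G \<longleftrightarrow>
    (\<forall>\<gamma>\<in>curves \<tau> A a. G \<gamma> \<in> tangent_space \<tau> A \<and>
       has_differential \<tau> A a E \<gamma> (L2_metric I \<gamma> (G \<gamma>)))"

definition symplectic_gradient ::
  "(real \<Rightarrow> real) \<Rightarrow> real set \<Rightarrow> real^3^3 \<Rightarrow> real^3 \<Rightarrow> ((real \<Rightarrow> real^3) \<Rightarrow> real) \<Rightarrow>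
   ((real \<Rightarrow> real^3) \<Rightarrow> (real \<Rightarrow> real^3)) \<Rightarrow> bool"
  where "symplectic_gradient \<tau> I A a E Y \<longleftrightarrow>
    (\<forall>\<gamma>\<in>curves \<tau> A a. Y \<gamma> \<in> tangent_space \<tau> A \<and>
       has_differential \<tau> A a E \<gamma> (presymplectic I \<gamma> (Y \<gamma>)))"

text \<open>Congruence of vector fields on the space of curves modulo function multiples of the unit
  tangent. For each curve the multiplier is a smooth function on \<open>M\<close>; it has to be invariant under
  \<open>\<tau>\<close> for the multiple of the unit tangent to be a tangent vector.\<close>

definition cong_mod_tangent ::
  "(real \<Rightarrow> real) \<Rightarrow> real^3^3 \<Rightarrow> real^3 \<Rightarrow> ((real \<Rightarrow> real^3) \<Rightarrow> (real \<Rightarrow> real^3)) \<Rightarrow>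
   ((real \<Rightarrow> real^3) \<Rightarrow> (real \<Rightarrow> real^3)) \<Rightarrow> bool"
  where "cong_mod_tangent \<tau> A a Y Z \<longleftrightarrow>
    (\<forall>\<gamma>\<in>curves \<tau> A a. \<exists>f :: real \<Rightarrow> real. smooth_on UNIV f \<and> (\<forall>s. f (\<tau> s) = f s) \<and>
       (\<forall>s. Y \<gamma> s = Z \<gamma> s + f s *\<^sub>R unit_tangent \<gamma> s))"


section \<open>Flux functionals\<close>

text \<open>A 1-form on space is a function \<open>\<alpha>\<close> of a base point and a tangent vector.\<close>

definition smooth_one_form :: "(real^3 \<Rightarrow> real^3 \<Rightarrow> real) \<Rightarrow> bool"
  where "smooth_one_form \<alpha> \<longleftrightarrow> (\<forall>p. linear (\<alpha> p)) \<and> (\<forall>X. smooth_on UNIV (\<lambda>p. \<alpha> p X))"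

definition ext_derivative ::
  "(real^3 \<Rightarrow> real^3 \<Rightarrow> real) \<Rightarrow> real^3 \<Rightarrow> real^3 \<Rightarrow> real^3 \<Rightarrow> real"
  where "ext_derivative \<alpha> p X Y =
    frechet_derivative (\<lambda>q. \<alpha> q Y) (at p) X - frechet_derivative (\<lambda>q. \<alpha> q X) (at p) Y"

definition pullback ::
  "(real^3 \<Rightarrow> real^3) \<Rightarrow> (real^3 \<Rightarrow> real^3 \<Rightarrow> real) \<Rightarrow> real^3 \<Rightarrow> real^3 \<Rightarrow> real"
  where "pullback g \<alpha> p X = \<alpha> (g p) (frechet_derivative g (at p) X)"

text \<open>The Lie derivative of the determinant form along \<open>V\<close> vanishes.\<close>

definition volume_preserving_field :: "(real^3 \<Rightarrow> real^3) \<Rightarrow> bool"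
  where "volume_preserving_field V \<longleftrightarrow> smooth_on UNIV V \<and>
    (\<forall>p X Y Z. let D = frechet_derivative V (at p) in
       det (vector [D X, Y, Z] :: real^3^3) + det (vector [X, D Y, Z] :: real^3^3)
         + det (vector [X, Y, D Z] :: real^3^3) = 0)"

definition invariant_primitive ::
  "(real^3 \<Rightarrow> real^3) \<Rightarrow> (real^3 \<Rightarrow> real^3) \<Rightarrow> (real^3 \<Rightarrow> real^3 \<Rightarrow> real) \<Rightarrow> bool"
  where "invariant_primitive h V \<alpha> \<longleftrightarrow> smooth_one_form \<alpha> \<and>
    (\<forall>p X Y. ext_derivative \<alpha> p X Y = det (vector [V p, X, Y] :: real^3^3)) \<and>
    pullback h \<alpha> = \<alpha>"

definition flux :: "real set \<Rightarrow> (real^3 \<Rightarrow> real^3 \<Rightarrow> real) \<Rightarrow> (real \<Rightarrow> real^3) \<Rightarrow> real"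
  where "flux I \<alpha> \<gamma> = integral I (\<lambda>s. \<alpha> (\<gamma> s) (vector_derivative \<gamma> (at s)))"

definition translation_primitive :: "real^3 \<Rightarrow> real^3 \<Rightarrow> real^3 \<Rightarrow> real"
  where "translation_primitive v p X = 1/2 * det (vector [v, p, X] :: real^3^3)"

definition E_minus_1 :: "real set \<Rightarrow> real^3 \<Rightarrow> (real \<Rightarrow> real^3) \<Rightarrow> real"
  where "E_minus_1 I v \<gamma> = 1/2 * integral I (\<lambda>s. cross3 (\<gamma> s) (vector_derivative \<gamma> (at s)) \<bullet> v)"


section \<open>Projections and signed enclosed area\<close>

definition orth_projection :: "real^3 \<Rightarrow> real^3 \<Rightarrow> real^3"
  where "orth_projection v p = p - (p \<bullet> v) *\<^sub>R v"

text \<open>For unit \<open>v\<close>: a positively oriented orthonormal basis of the plane perpendicular to \<open>v\<close>, where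
  the plane is oriented by its normal \<open>v\<close>.\<close>

definition oriented_basis :: "real^3 \<Rightarrow> real^3 \<Rightarrow> real^3 \<Rightarrow> bool"
  where "oriented_basis v e1 e2 \<longleftrightarrow> norm e1 = 1 \<and> norm e2 = 1 \<and> e1 \<bullet> e2 = 0 \<and> cross3 e1 e2 = v"

text \<open>The projection of \<open>\<gamma>\<close>, restricted to the fundamental domain \<open>I\<close> in positive direction,
  as a path in the plane, which is identified with the complex numbers by an oriented basis.\<close>

definition projected_path ::
  "real set \<Rightarrow> real^3 \<Rightarrow> real^3 \<Rightarrow> real^3 \<Rightarrow> (real \<Rightarrow> real^3) \<Rightarrow> real \<Rightarrow> complex"
  where "projected_path I v e1 e2 \<gamma> =
    (\<lambda>p. Complex (p \<bullet> e1) (p \<bullet> e2)) \<circ> orth_projection v \<circ> \<gamma> \<circ> linepath (Inf I) (Sup I)"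

text \<open>Each point of the plane is counted with its winding number. The values of the winding number
  on the path itself are irrelevant, as this is a null set for piecewise smooth paths.\<close>

definition has_signed_area :: "(real \<Rightarrow> complex) \<Rightarrow> real \<Rightarrow> bool"
  where "has_signed_area c r \<longleftrightarrow>
    (\<lambda>z. Re (winding_number c z)) absolutely_integrable_on UNIV \<and>
    integral UNIV (\<lambda>z. Re (winding_number c z)) = r"

end

theory Submission
  imports Defs
begin

text \<open>
  The functional \<open>E = E\<^sub>-\<^sub>1\<close> is a quadratic form in the curve, so its differential can be read off
  from an exact difference formula. For two curves \<open>\<gamma>\<close>, \<open>\<beta>\<close> with the same monodromy the function
  \<open>(\<gamma> \<times> \<beta>, v)\<close> is invariant under \<open>\<tau>\<close>: the rotation \<open>A\<close> fixes \<open>v\<close> and the translation part \<open>a\<close> is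
  parallel to \<open>v\<close>. Its derivative therefore integrates to zero over a fundamental domain, and
  \<open>E \<beta> - E \<gamma> = 1/2 \<integral> ((\<beta> - \<gamma>) \<times> (\<gamma>' + \<beta>'), v)\<close> (lemma \<open>E_difference\<close>). Along a variation with
  velocity \<open>\<xi>\<close>, dividing by the parameter and passing to the limit gives
  \<open>dE(\<xi>) = \<integral> (\<xi> \<times> \<gamma>', v) = \<langle>T \<times> v, \<xi>\<rangle>\<close> (\<open>differential_E\<close>); mixed second derivatives
  of the variation never enter.

  Both gradients come from this formula together with one uniqueness statement
  (\<open>differential_eq_L2_iff\<close>): a tangent vector \<open>Z\<close> represents \<open>dE\<close> through the metric only if
  \<open>Z = T \<times> v\<close>, which follows by testing with \<open>\<xi> = Z - T \<times> v\<close> along the affine variation \<open>\<gamma> + t \<xi>\<close>.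
  Since \<open>\<sigma>(Y, \<cdot>) = \<langle>T \<times> Y, \<cdot>\<rangle>\<close>, a symplectic gradient is a field \<open>Y\<close> with \<open>T \<times> Y = T \<times> v\<close>, that
  is, \<open>Y\<close> and \<open>v\<close> differ by a multiple of \<open>T\<close>.

  For the signed area let \<open>c\<close> be a closed plane \<open>C\<^sup>1\<close> curve. Its winding number around \<open>z\<close> is the
  integral of \<open>c'/(c - z)\<close> divided by \<open>2 \<pi> \<i>\<close>. The Cauchy kernel is locally integrable in the
  plane, so Fubini reduces the integral of the winding number over a large square \<open>Q\<close> to
  \<open>J(w) = \<integral>\<^sub>Q 1/(w - z) dz\<close> at \<open>w = c t\<close>. Integrating along horizontal lines by logarithms shows
  \<open>J(w) = h(w) - 2 \<pi> \<i> Im w\<close> with \<open>h\<close> holomorphic on a strip containing the curve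
  (\<open>integral_Cauchy_kernel_square\<close>); the second term collects the jumps of the principal logarithm.
  By Cauchy's theorem \<open>h\<close> contributes nothing, so the winding number integrates to
  \<open>- \<integral> c' Im c\<close>, whose real part is the usual area integral (\<open>C1_loop.signed_area\<close>). The
  projection of \<open>\<gamma>\<close> along \<open>v\<close> turns this integral into \<open>E\<close>.
\<close>

section \<open>The Cauchy kernel in the plane\<close>

text \<open>Makes iterated integration over the real and the imaginary part available.\<close>

lemma lborel_complex_eq:
  "(lborel :: complex measure) = distr (lborel :: (real \<times> real) measure) borel (\<lambda>(x, y). Complex x y)"
proof (rule lborel_eqI)
  have cont: "continuous_on UNIV (\<lambda>p::real\<times>real. Complex (fst p) (snd p))"
    by (simp add: Complex_eq) (intro continuous_intros)
  have [measurable]: "(\<lambda>p::real\<times>real. Complex (fst p) (snd p)) \<in> borel_measurable borel"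
    by (intro borel_measurable_continuous_onI cont)
  fix l u :: complex
  assume le: "\<And>b. b \<in> Basis \<Longrightarrow> l \<bullet> b \<le> u \<bullet> b"
  have le': "Re l \<le> Re u" "Im l \<le> Im u"
    using le[of 1] le[of \<i>] by (auto simp: Basis_complex_def inner_complex_def)
  have pre: "(\<lambda>p::real\<times>real. Complex (fst p) (snd p)) -` box l u = {Re l<..<Re u} \<times> {Im l<..<Im u}"
    by (auto simp: box_def Basis_complex_def inner_complex_def)
  have "emeasure (distr (lborel :: (real \<times> real) measure) borel (\<lambda>(x, y). Complex x y)) (box l u)
      = emeasure (lborel :: (real \<times> real) measure) ({Re l<..<Re u} \<times> {Im l<..<Im u})"
    unfolding case_prod_unfold by (subst emeasure_distr) (auto simp: pre)
  also have "\<dots> = emeasure (lborel \<Otimes>\<^sub>M lborel :: (real \<times> real) measure) ({Re l<..<Re u} \<times> {Im l<..<Im u})"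
    by (simp add: lborel_prod)
  also have "\<dots> = ennreal (Re u - Re l) * ennreal (Im u - Im l)"
    using le' by (subst lborel.emeasure_pair_measure_Times) auto
  also have "\<dots> = ennreal (\<Prod>b\<in>Basis. (u - l) \<bullet> b)"
    using le' by (simp add: Basis_complex_def inner_complex_def ennreal_mult)
  finally show "emeasure (distr (lborel :: (real \<times> real) measure) borel (\<lambda>(x, y). Complex x y)) (box l u)
      = ennreal (\<Prod>b\<in>Basis. (u - l) \<bullet> b)" .
qed simp

lemma measurable_Complex [measurable]:
  "(\<lambda>(x, y). Complex x y) \<in> borel_measurable (borel :: (real \<times> real) measure)"
  unfolding case_prod_unfold
  by (intro borel_measurable_continuous_onI) (simp add: Complex_eq, intro continuous_intros)

lemma nn_integral_complex:
  assumes [measurable]: "f \<in> borel_measurable borel"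
  shows "(\<integral>\<^sup>+z. f z \<partial>lborel) = (\<integral>\<^sup>+x. (\<integral>\<^sup>+y. f (Complex x y) \<partial>lborel) \<partial>lborel)"
proof -
  have m: "(\<lambda>(x, y). f (Complex x y)) \<in> borel_measurable (lborel \<Otimes>\<^sub>M lborel)"
    using measurable_comp[OF measurable_Complex assms] by (simp add: lborel_prod o_def case_prod_unfold)
  show ?thesis
    unfolding lborel_complex_eq
    by (subst nn_integral_distr)
       (use lborel.nn_integral_fst[OF m] in \<open>simp_all add: lborel_prod case_prod_unfold measurable_Complex[unfolded case_prod_unfold]\<close>)
qed

text \<open>The imaginary part is made the outer variable because the Cauchy kernel has an elementary
  primitive along horizontal lines.\<close>

lemma integral_complex_swapped:
  fixes f :: "complex \<Rightarrow> 'a::{banach, second_countable_topology}"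
  assumes f: "integrable lborel f"
  shows "(\<integral>z. f z \<partial>lborel) = (\<integral>y. (\<integral>x. f (Complex x y) \<partial>lborel) \<partial>lborel)"
proof -
  have [measurable]: "f \<in> borel_measurable borel" using f by auto
  have i: "integrable (lborel \<Otimes>\<^sub>M lborel) (\<lambda>(x, y). f (Complex x y))"
    using f unfolding lborel_complex_eq
    by (subst (asm) integrable_distr_eq)
       (simp_all add: lborel_prod case_prod_unfold measurable_Complex[unfolded case_prod_unfold])
  show ?thesis
    unfolding lborel_complex_eq
    by (subst integral_distr)
       (use lborel_pair.integral_snd[OF i] in \<open>simp_all add: lborel_prod case_prod_unfold measurable_Complex[unfolded case_prod_unfold]\<close>)
qed

lemma nn_integral_inverse_sqrt:
  assumes "R > 0" "\<bar>x\<bar> \<le> R"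
  shows "(\<integral>\<^sup>+u. ennreal (indicator {-R..R} u * \<bar>x - u\<bar> powr (-1/2)) \<partial>lborel)
    \<le> ennreal (4 * (2 * R) powr (1/2))"
proof -
  let ?g = "\<lambda>s::real. indicator {-2*R..2*R} s * \<bar>s\<bar> powr (-1/2)"
  have p: "((\<lambda>s. \<bar>s\<bar> powr (-1/2)) has_integral 2 * (2*R) powr (1/2)) {0..2*R}"
    using has_integral_powr_from_0[of "-1/2" "2*R"] assms
    by (auto simp: mult.commute intro: has_integral_eq[rotated])
  have "((\<lambda>s. \<bar>-s\<bar> powr (-1/2)) has_integral 2 * (2*R) powr (1/2)) {-2*R..0}"
    using p has_integral_reflect_real[of "\<lambda>s. \<bar>s\<bar> powr (-1/2)" _ "2*R" 0] by simp
  then have "((\<lambda>s. \<bar>s\<bar> powr (-1/2)) has_integral (2 * (2*R) powr (1/2) + 2 * (2*R) powr (1/2))) {-2*R..2*R}"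
    using p assms by (intro has_integral_combine[where c=0]) auto
  then have "((\<lambda>s. if s \<in> {-2*R..2*R} then \<bar>s\<bar> powr (-1/2) else 0) has_integral 4 * (2*R) powr (1/2)) UNIV"
    by (subst has_integral_restrict_UNIV) (simp add: field_simps)
  also have "(\<lambda>s. if s \<in> {-2*R..2*R} then \<bar>s\<bar> powr (-1/2) else 0) = ?g"
    by (auto simp: indicator_def)
  finally have I: "(?g has_integral 4 * (2*R) powr (1/2)) UNIV" .
  have "(\<integral>\<^sup>+u. ennreal (indicator {-R..R} u * \<bar>x - u\<bar> powr (-1/2)) \<partial>lborel)
      \<le> (\<integral>\<^sup>+u. ennreal (?g (x + (-1) * u)) \<partial>lborel)"
    using assms by (intro nn_integral_mono) (auto simp: indicator_def)
  also have "\<dots> = (\<integral>\<^sup>+s. ennreal (?g s) \<partial>lborel)"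
    by (subst nn_integral_real_affine[where c="-1" and t=x and f="\<lambda>s. ennreal (?g s)"]) auto
  also have "\<dots> = ennreal (4 * (2*R) powr (1/2))"
    by (rule nn_integral_has_integral_lborel[OF _ _ I]) auto
  finally show ?thesis .
qed

text \<open>This bound splits the singularity of the Cauchy kernel into two one-dimensional singularities
  of order \<open>-1/2\<close>, which are integrable.\<close>

lemma inverse_norm_le:
  fixes x y :: real
  assumes "x \<noteq> 0" "y \<noteq> 0"
  shows "1 / cmod (Complex x y) \<le> \<bar>x\<bar> powr (-1/2) * \<bar>y\<bar> powr (-1/2)"
proof -
  have "\<bar>x\<bar> * \<bar>y\<bar> \<le> x\<^sup>2 + y\<^sup>2"
  proof -
    have "2 * (\<bar>x\<bar> * \<bar>y\<bar>) \<le> x\<^sup>2 + y\<^sup>2"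
      using sum_squares_bound[of "\<bar>x\<bar>" "\<bar>y\<bar>"] by simp
    moreover have "0 \<le> \<bar>x\<bar> * \<bar>y\<bar>" by simp
    ultimately show ?thesis by linarith
  qed
  then have "sqrt (\<bar>x\<bar> * \<bar>y\<bar>) \<le> cmod (Complex x y)"
    by (simp add: complex_norm)
  moreover have "0 < sqrt (\<bar>x\<bar> * \<bar>y\<bar>)" using assms by simp
  ultimately have "1 / cmod (Complex x y) \<le> 1 / sqrt (\<bar>x\<bar> * \<bar>y\<bar>)"
    by (intro divide_left_mono mult_pos_pos) auto
  also have "1 / sqrt (\<bar>x\<bar> * \<bar>y\<bar>) = \<bar>x\<bar> powr (-1/2) * \<bar>y\<bar> powr (-1/2)"
    using assms by (simp add: powr_minus powr_half_sqrt real_sqrt_mult field_simps)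
  finally show ?thesis .
qed

definition square :: "real \<Rightarrow> complex set" where
  "square R = {z. \<bar>Re z\<bar> \<le> R \<and> \<bar>Im z\<bar> \<le> R}"

lemma square_borel [measurable]: "square R \<in> sets borel"
  unfolding square_def by measurable

text \<open>Uniformity in the pole \<open>w\<close> is what makes the kernel integrable jointly in the plane variable
  and the curve parameter.\<close>

lemma nn_integral_Cauchy_kernel_le:
  assumes "R > 0" "w \<in> square R"
  shows "(\<integral>\<^sup>+z. ennreal (indicator (square R) z / cmod (w - z)) \<partial>lborel)
    \<le> ennreal ((4 * (2 * R) powr (1/2))\<^sup>2)"
proof -
  let ?C = "4 * (2 * R) powr (1/2)"
  let ?p = "\<lambda>x u. indicator {-R..R} u * \<bar>x - u\<bar> powr (-1/2) :: real"
  have w: "\<bar>Re w\<bar> \<le> R" "\<bar>Im w\<bar> \<le> R" using assms by (auto simp: square_def)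
  have "(\<integral>\<^sup>+z. ennreal (indicator (square R) z / cmod (w - z)) \<partial>lborel)
     = (\<integral>\<^sup>+u. (\<integral>\<^sup>+v. ennreal (indicator (square R) (Complex u v) / cmod (w - Complex u v)) \<partial>lborel) \<partial>lborel)"
    by (rule nn_integral_complex) measurable
  also have "\<dots> \<le> (\<integral>\<^sup>+u. (\<integral>\<^sup>+v. ennreal (?p (Re w) u) * ennreal (?p (Im w) v) \<partial>lborel) \<partial>lborel)"
  proof (rule nn_integral_mono_AE, rule AE_mp[OF AE_lborel_singleton[of "Re w"]], rule AE_I2, rule impI)
    fix u assume u: "u \<noteq> Re w"
    show "(\<integral>\<^sup>+v. ennreal (indicator (square R) (Complex u v) / cmod (w - Complex u v)) \<partial>lborel)
       \<le> (\<integral>\<^sup>+v. ennreal (?p (Re w) u) * ennreal (?p (Im w) v) \<partial>lborel)"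
    proof (rule nn_integral_mono_AE, rule AE_mp[OF AE_lborel_singleton[of "Im w"]], rule AE_I2, rule impI)
      fix v assume v: "v \<noteq> Im w"
      have "w - Complex u v = Complex (Re w - u) (Im w - v)" by (simp add: complex_eq_iff)
      then show "ennreal (indicator (square R) (Complex u v) / cmod (w - Complex u v))
         \<le> ennreal (?p (Re w) u) * ennreal (?p (Im w) v)"
        using inverse_norm_le[of "Re w - u" "Im w - v"] u v
        by (auto simp: indicator_def square_def ennreal_mult[symmetric] intro!: ennreal_leI)
    qed
  qed
  also have "\<dots> = (\<integral>\<^sup>+u. ennreal (?p (Re w) u) \<partial>lborel) * (\<integral>\<^sup>+v. ennreal (?p (Im w) v) \<partial>lborel)"
    by (simp add: nn_integral_cmult nn_integral_multc)
  also have "\<dots> \<le> ennreal ?C * ennreal ?C"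
    using w assms by (intro mult_mono nn_integral_inverse_sqrt) auto
  also have "\<dots> = ennreal (?C\<^sup>2)"
    by (subst ennreal_mult[symmetric]) (auto simp: power2_eq_square)
  finally show ?thesis .
qed

text \<open>The regular part of the horizontal integral of the Cauchy kernel: both arguments have positive
  real part when \<open>\<bar>Re w\<bar> < R\<close>, so no branch cut is met and the dependence on \<open>w\<close> is holomorphic.\<close>

definition log_potential :: "real \<Rightarrow> complex \<Rightarrow> real \<Rightarrow> complex" where
  "log_potential R w v = Ln (R + w - \<i> * v) - Ln (R - w + \<i> * v)"

lemma complex_not_nonpos_Reals: "Re z > 0 \<or> Im z \<noteq> 0 \<Longrightarrow> z \<notin> \<real>\<^sub>\<le>\<^sub>0"
  by (auto simp: complex_nonpos_Reals_iff)

text \<open>A primitive of the integrand is \<open>- Ln (w - z)\<close>, which never meets the branch cut because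
  \<open>w - z\<close> keeps a constant nonzero imaginary part. At the right end \<open>w - z\<close> lies in the left half plane;
  reflecting it to the right half plane costs \<open>\<i> \<pi>\<close> with a sign that depends on the side on which the
  line passes \<open>w\<close>. This sign is the entire topological content of the area formula.\<close>

lemma integral_Cauchy_kernel_line:
  assumes w: "\<bar>Re w\<bar> < R" and v: "v \<noteq> Im w"
  shows "(\<integral>u. indicator {-R..R} u *\<^sub>R (1 / (w - Complex u v)) \<partial>lborel)
    = log_potential R w v - \<i> * pi * sgn (Im w - v)"
proof -
  have [simp]: "w \<noteq> Complex u v" for u using v by auto
  have nz: "w - Complex u v \<notin> \<real>\<^sub>\<le>\<^sub>0" for u
    using v by (intro complex_not_nonpos_Reals) auto
  have "(\<integral>u. indicator {-R..R} u *\<^sub>R (1 / (w - Complex u v)) \<partial>lborel)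
      = - Ln (w - Complex R v) - (- Ln (w - Complex (-R) v))"
  proof (rule integral_FTC_Icc)
    fix u :: real
    have 1: "((\<lambda>z. - Ln (w - (z + \<i> * v))) has_field_derivative 1 / (w - Complex u v)) (at (of_real u))"
      using nz[of u] by (auto intro!: derivative_eq_intros simp: Complex_eq divide_inverse)
    show "((\<lambda>u. - Ln (w - Complex u v)) has_vector_derivative 1 / (w - Complex u v)) (at u within {-R..R})"
      using has_vector_derivative_real_field[OF 1] by (simp add: Complex_eq)
  qed (use w in \<open>auto simp: Complex_eq[abs_def] intro!: continuous_intros, simp add: Complex_eq[symmetric]\<close>)
  also have "w - Complex (-R) v = R + w - \<i> * v" by (simp add: Complex_eq algebra_simps)
  also have "w - Complex R v = - (R - w + \<i> * v)" by (simp add: Complex_eq algebra_simps)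
  also have "Ln (- (R - w + \<i> * v)) = Ln (R - w + \<i> * v) + \<i> * pi * sgn (Im w - v)"
  proof -
    have "R - w + \<i> * v \<noteq> 0" using v by (auto simp: complex_eq_iff)
    then show ?thesis
      using w v by (subst Ln_minus) (auto simp: sgn_if)
  qed
  finally show ?thesis by (simp add: log_potential_def algebra_simps)
qed

lemma continuous_on_log_potential:
  assumes "\<bar>Re w\<bar> < R"
  shows "continuous_on S (log_potential R w)"
  unfolding log_potential_def
  using assms by (intro continuous_intros complex_not_nonpos_Reals) auto

lemma convex_strip: "convex {w. \<bar>Re w\<bar> < R}"
proof -
  have "{w. \<bar>Re w\<bar> < R} = {w. Re w < R} \<inter> {w. Re w > -R}" by auto
  then show ?thesis
    by (simp add: convex_Int convex_halfspace_Re_lt convex_halfspace_Re_gt)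
qed

lemma log_potential_integral_holomorphic:
  "(\<lambda>w. integral {-R..R} (log_potential R w)) holomorphic_on {w. \<bar>Re w\<bar> < R}"
proof -
  have "(\<lambda>w. integral (cbox (-R) R) (log_potential R w)) holomorphic_on {w. \<bar>Re w\<bar> < R}"
  proof (rule leibniz_rule_holomorphic[where f = "log_potential R" and fx = "\<lambda>w v. 1 / (R + w - \<i> * v) + 1 / (R - w + \<i> * v)"])
    fix w :: complex and v :: real assume w: "w \<in> {w. \<bar>Re w\<bar> < R}"
    then have n: "R + w - \<i> * v \<notin> \<real>\<^sub>\<le>\<^sub>0" "R - w + \<i> * v \<notin> \<real>\<^sub>\<le>\<^sub>0"
      by (auto intro!: complex_not_nonpos_Reals)
    show "((\<lambda>w. log_potential R w v) has_field_derivative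
        1 / (R + w - \<i> * v) + 1 / (R - w + \<i> * v)) (at w within {w. \<bar>Re w\<bar> < R})"
      unfolding log_potential_def
      using n by (auto intro!: derivative_eq_intros simp: divide_inverse)
  next
    fix w :: complex assume "w \<in> {w. \<bar>Re w\<bar> < R}"
    then show "log_potential R w integrable_on cbox (-R) R"
      by (intro integrable_continuous continuous_on_log_potential) auto
  next
    have n: "R + w - \<i> * v \<noteq> 0" "R - w + \<i> * v \<noteq> 0" if "\<bar>Re w\<bar> < R" for w :: complex and v :: real
      using that by (auto simp: complex_eq_iff)
    show "continuous_on ({w. \<bar>Re w\<bar> < R} \<times> cbox (-R) R)
        (\<lambda>(w::complex, v::real). 1 / (R + w - \<i> * v) + 1 / (R - w + \<i> * v))"
      unfolding case_prod_unfold using n by (intro continuous_intros) auto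
  qed (rule convex_strip)
  then show ?thesis by simp
qed

lemma integrable_Cauchy_kernel:
  assumes "R > 0" "w \<in> square R"
  shows "integrable lborel (\<lambda>z. indicator (square R) z *\<^sub>R (1 / (w - z)))"
proof (rule integrableI_bounded)
  have "(\<integral>\<^sup>+z. ennreal (norm (indicator (square R) z *\<^sub>R (1 / (w - z)))) \<partial>lborel)
      = (\<integral>\<^sup>+z. ennreal (indicator (square R) z / cmod (w - z)) \<partial>lborel)"
    by (intro nn_integral_cong) (simp add: norm_divide)
  also have "\<dots> < \<infinity>"
    using nn_integral_Cauchy_kernel_le[OF assms] by (auto simp: order_le_less_trans)
  finally show "(\<integral>\<^sup>+z. ennreal (norm (indicator (square R) z *\<^sub>R (1 / (w - z)))) \<partial>lborel) < \<infinity>" .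
qed measurable

text \<open>Integrating the sign \<open>sgn (Im w - v)\<close> over \<open>-R \<le> v \<le> R\<close> gives \<open>2 Im w\<close>, hence the only
  term that is not holomorphic in \<open>w\<close>.\<close>

lemma integral_Cauchy_kernel_square:
  assumes w: "\<bar>Re w\<bar> < R" "\<bar>Im w\<bar> < R"
  shows "(\<integral>z. indicator (square R) z *\<^sub>R (1 / (w - z)) \<partial>lborel)
    = integral {-R..R} (log_potential R w) - 2 * pi * \<i> * Im w"
proof -
  have R: "R > 0" and sq: "w \<in> square R" using w by (auto simp: square_def)
  let ?y = "Im w"
  let ?a = "\<lambda>v. indicator {-R..R} v *\<^sub>R log_potential R w v"
  have "(\<integral>z. indicator (square R) z *\<^sub>R (1 / (w - z)) \<partial>lborel)
     = (\<integral>v. (\<integral>u. indicator (square R) (Complex u v) *\<^sub>R (1 / (w - Complex u v)) \<partial>lborel) \<partial>lborel)"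
    by (rule integral_complex_swapped[OF integrable_Cauchy_kernel[OF R sq]])
  also have "\<dots> = (\<integral>v. indicator {-R..R} v *\<^sub>R
      (\<integral>u. indicator {-R..R} u *\<^sub>R (1 / (w - Complex u v)) \<partial>lborel) \<partial>lborel)"
    by (intro Bochner_Integration.integral_cong)
       (auto simp: square_def indicator_def abs_le_iff intro!: Bochner_Integration.integral_cong)
  \<comment> \<open>The two indicators differ by the sign of \<open>Im w - v\<close>, except on the null set \<open>v = Im w\<close>.\<close>
  also have "\<dots> = (\<integral>v. ?a v - (\<i> * pi) * (of_real (indicator {-R..?y} v) - of_real (indicator {?y..R} v)) \<partial>lborel)"
  proof (rule integral_cong_AE)
    have "set_borel_measurable lborel {-R..R} (log_potential R w)"
      by (simp add: set_borel_measurable_def borel_measurable_continuous_on_indicator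
          continuous_on_log_potential w)
    then have [measurable]: "?a \<in> borel_measurable borel"
      by (simp add: set_borel_measurable_def)
    show "(\<lambda>v. ?a v - (\<i> * pi) * (of_real (indicator {-R..?y} v) - of_real (indicator {?y..R} v)))
        \<in> borel_measurable lborel" by measurable
    have [measurable]: "(\<lambda>(v, u). Complex u v) \<in> borel_measurable (borel \<Otimes>\<^sub>M borel)"
      unfolding borel_prod case_prod_unfold
      by (intro borel_measurable_continuous_onI) (simp add: Complex_eq, intro continuous_intros)
    show "(\<lambda>v. indicator {-R..R} v *\<^sub>R
      (\<integral>u. indicator {-R..R} u *\<^sub>R (1 / (w - Complex u v)) \<partial>lborel)) \<in> borel_measurable lborel"
      by measurable
    show "AE v in lborel. indicator {-R..R} v *\<^sub>R
      (\<integral>u. indicator {-R..R} u *\<^sub>R (1 / (w - Complex u v)) \<partial>lborel)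
       = ?a v - (\<i> * pi) * (of_real (indicator {-R..?y} v) - of_real (indicator {?y..R} v))"
    proof (rule AE_mp[OF AE_lborel_singleton[of "Im w"]], rule AE_I2, rule impI)
      fix v assume "v \<noteq> Im w"
      then show "indicator {-R..R} v *\<^sub>R
          (\<integral>u. indicator {-R..R} u *\<^sub>R (1 / (w - Complex u v)) \<partial>lborel)
        = ?a v - (\<i> * pi) * (of_real (indicator {-R..?y} v) - of_real (indicator {?y..R} v))"
        using w by (subst integral_Cauchy_kernel_line) (auto simp: indicator_def sgn_if)
    qed
  qed
  also have "\<dots> = (\<integral>v. ?a v \<partial>lborel) - (\<i> * pi) * ((?y + R) - (R - ?y))"
  proof -
    have 1: "integrable lborel ?a"
      using borel_integrable_atLeastAtMost'[OF continuous_on_log_potential[OF w(1)]]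
      by (simp add: set_integrable_def)
    have 2: "has_bochner_integral lborel (\<lambda>v. of_real (indicator {-R..?y} v) - of_real (indicator {?y..R} v) :: complex)
       (of_real (?y + R) - of_real (R - ?y))"
      using w by (intro has_bochner_integral_diff has_bochner_integral_of_real)
         (auto simp: has_bochner_integral_iff)
    show ?thesis
      using 1 2 by (simp add: has_bochner_integral_iff)
  qed
  also have "(\<integral>v. ?a v \<partial>lborel) = integral {-R..R} (log_potential R w)"
    using set_borel_integral_eq_integral(2)[OF borel_integrable_atLeastAtMost'[OF continuous_on_log_potential[OF w(1)]]]
    by (simp add: set_lebesgue_integral_def)
  finally show ?thesis by (simp add: algebra_simps)
qed


section \<open>Integrating the winding number\<close>

locale C1_loop =
  fixes c c' :: "real \<Rightarrow> complex"
  assumes deriv: "\<And>t. (c has_vector_derivative c' t) (at t)"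
    and cont_deriv: "continuous_on UNIV c'"
    and closed: "c 0 = c 1"
begin

lemma cont: "continuous_on S c"
  by (intro differentiable_imp_continuous_on ballI differentiable_at_imp_differentiable_on)
     (use deriv differentiableI_vector in blast)

lemma valid: "valid_path c"
  unfolding valid_path_def
  by (rule C1_differentiable_imp_piecewise)
     (auto simp: C1_differentiable_on_def intro!: exI[of _ c'] deriv continuous_on_subset[OF cont_deriv])

lemma contour_integral_eq: "contour_integral c f = integral {0..1} (\<lambda>t. f (c t) * c' t)"
  unfolding contour_integral_integral
  by (intro integral_cong arg_cong2[where f=times] refl vector_derivative_within_cbox[of 0 1, simplified])
     (use deriv in \<open>auto intro: has_vector_derivative_at_within vector_derivative_at\<close>)

lemma negligible_path_image: "negligible (path_image c)"
  unfolding path_image_def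
  by (intro negligible_differentiable_image_lowdim differentiable_at_imp_differentiable_on)
     (use deriv differentiableI_vector in auto)

text \<open>The two expressions differ by half the integral of the derivative of \<open>Re c * Im c\<close>, which
  vanishes because the curve is closed.\<close>

lemma area_integral_by_parts:
  "- integral {0..1} (\<lambda>t. Im (c t) * Re (c' t))
   = 1/2 * integral {0..1} (\<lambda>t. Re (c t) * Im (c' t) - Im (c t) * Re (c' t))"
proof -
  have "((\<lambda>t. Re (c t) * Im (c t)) has_vector_derivative
      Re (c t) * Im (c' t) + Im (c t) * Re (c' t)) (at t within {0..1})" for t
    using has_vector_derivative_at_within[OF deriv[of t], of "{0..1}"]
    by (auto intro!: derivative_eq_intros simp: algebra_simps
         simp flip: has_real_derivative_iff_has_vector_derivative)
  then have "((\<lambda>t. Re (c t) * Im (c' t) + Im (c t) * Re (c' t)) has_integral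
      Re (c 1) * Im (c 1) - Re (c 0) * Im (c 0)) {0..1}"
    by (intro fundamental_theorem_of_calculus) auto
  then have 0: "integral {0..1} (\<lambda>t. Re (c t) * Im (c' t) + Im (c t) * Re (c' t)) = 0"
    by (simp add: closed integral_unique)
  have [continuous_intros]: "continuous_on {0..1} c'"
    using cont_deriv continuous_on_subset by blast
  have 1: "(\<lambda>t. Re (c t) * Im (c' t)) integrable_on {0..1}"
     "(\<lambda>t. Im (c t) * Re (c' t)) integrable_on {0..1}"
    by (auto intro!: integrable_continuous_real continuous_intros cont)
  show ?thesis using 0 1
    by (simp add: Henstock_Kurzweil_Integration.integral_add Henstock_Kurzweil_Integration.integral_diff)
qed

lemma curve_in_open_square: "\<exists>R>0. \<forall>t\<in>{0..1}. \<bar>Re (c t)\<bar> < R \<and> \<bar>Im (c t)\<bar> < R"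
proof -
  have "bounded (c ` {0..1})"
    by (intro compact_imp_bounded compact_continuous_image cont) auto
  then obtain B where B: "B > 0" "\<And>t. t \<in> {0..1} \<Longrightarrow> cmod (c t) < B"
    by (force simp: bounded_pos_less)
  then show ?thesis
    using abs_Re_le_cmod abs_Im_le_cmod by (meson order_le_less_trans)
qed

definition kernel :: "real \<Rightarrow> real \<Rightarrow> complex \<Rightarrow> complex" where
  "kernel R t z = indicator {0..1} t *\<^sub>R (indicator (square R) z *\<^sub>R (c' t / (c t - z)))"

lemma kernel_measurable [measurable]:
  "(\<lambda>(t, z). kernel R t z) \<in> borel_measurable (lborel \<Otimes>\<^sub>M lborel)"
proof -
  have [measurable]: "c \<in> borel_measurable borel" "c' \<in> borel_measurable borel"
    by (intro borel_measurable_continuous_onI cont cont_deriv)+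
  show ?thesis unfolding kernel_def by measurable
qed

lemma integrable_kernel:
  assumes R: "\<And>t. t \<in> {0..1} \<Longrightarrow> \<bar>Re (c t)\<bar> < R \<and> \<bar>Im (c t)\<bar> < R"
  shows "integrable (lborel \<Otimes>\<^sub>M lborel) (\<lambda>(t, z). kernel R t z)"
proof (rule integrableI_bounded)
  have R0: "R > 0" using R[of 0] by auto
  have [measurable]: "c \<in> borel_measurable borel" "c' \<in> borel_measurable borel"
    by (intro borel_measurable_continuous_onI cont cont_deriv)+
  let ?C = "(4 * (2 * R) powr (1/2))\<^sup>2"
  have "compact (c' ` {0..1})"
    by (intro compact_continuous_image continuous_on_subset[OF cont_deriv]) auto
  then obtain K where K: "K > 0" "\<And>t. t \<in> {0..1} \<Longrightarrow> cmod (c' t) \<le> K"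
    by (force dest: compact_imp_bounded simp: bounded_pos)
  have "(\<integral>\<^sup>+p. ennreal (norm (case p of (t, z) \<Rightarrow> kernel R t z)) \<partial>(lborel \<Otimes>\<^sub>M lborel))
      = (\<integral>\<^sup>+t. (\<integral>\<^sup>+z. ennreal (norm (kernel R t z)) \<partial>lborel) \<partial>lborel)"
    by (subst lborel.nn_integral_fst[symmetric]) auto
  also have "\<dots> \<le> (\<integral>\<^sup>+t. ennreal (K * ?C) * indicator {0..1} (t::real) \<partial>lborel)"
  proof (rule nn_integral_mono)
    fix t :: real
    show "(\<integral>\<^sup>+z. ennreal (norm (kernel R t z)) \<partial>lborel) \<le> ennreal (K * ?C) * indicator {0..1} t"
    proof (cases "t \<in> {0..1}")
      case True
      then have sq: "c t \<in> square R" using R[of t] by (auto simp: square_def)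
      have "(\<integral>\<^sup>+z. ennreal (norm (kernel R t z)) \<partial>lborel)
         = (\<integral>\<^sup>+z. ennreal (cmod (c' t)) * ennreal (indicator (square R) z / cmod (c t - z)) \<partial>lborel)"
        using True by (intro nn_integral_cong) (simp add: kernel_def norm_divide ennreal_mult[symmetric])
      also have "\<dots> = ennreal (cmod (c' t)) * (\<integral>\<^sup>+z. ennreal (indicator (square R) z / cmod (c t - z)) \<partial>lborel)"
        by (rule nn_integral_cmult) measurable
      also have "\<dots> \<le> ennreal K * ennreal ?C"
        using K True by (intro mult_mono nn_integral_Cauchy_kernel_le R0 sq ennreal_leI) auto
      finally show ?thesis using True K by (simp add: ennreal_mult)
    qed (simp add: kernel_def)
  qed
  also have "\<dots> < \<infinity>"
    by (simp add: nn_integral_cmult_indicator ennreal_mult_less_top)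
  finally show "(\<integral>\<^sup>+p. ennreal (norm (case p of (t, z) \<Rightarrow> kernel R t z)) \<partial>(lborel \<Otimes>\<^sub>M lborel)) < \<infinity>" .
qed measurable

text \<open>Inside the square this is the integral formula for the winding number. Outside both sides
  vanish: the square is convex and contains the curve.\<close>

lemma integral_kernel_curve:
  assumes R: "\<And>t. t \<in> {0..1} \<Longrightarrow> \<bar>Re (c t)\<bar> < R \<and> \<bar>Im (c t)\<bar> < R"
    and z: "z \<notin> path_image c"
  shows "(\<integral>t. kernel R t z \<partial>lborel) = 2 * pi * \<i> * winding_number c z"
proof (cases "z \<in> square R")
  case True
  have ne: "c t \<noteq> z" if "t \<in> {0..1}" for t using z that by (auto simp: path_image_def)
  have co: "continuous_on {0..1} (\<lambda>t. c' t / (c t - z))"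
    using ne by (intro continuous_intros cont continuous_on_subset[OF cont_deriv]) auto
  have "(\<integral>t. kernel R t z \<partial>lborel) = (LINT t:{0..1}|lborel. c' t / (c t - z))"
    using True by (simp add: kernel_def set_lebesgue_integral_def)
  also have "\<dots> = integral {0..1} (\<lambda>t. c' t / (c t - z))"
    by (rule set_borel_integral_eq_integral(2)[OF borel_integrable_atLeastAtMost'[OF co]])
  also have "\<dots> = contour_integral c (\<lambda>w. 1 / (w - z))"
    by (simp add: contour_integral_eq)
  also have "\<dots> = 2 * pi * \<i> * winding_number c z"
    by (simp add: winding_number_valid_path[OF valid z])
  finally show ?thesis .
next
  case False
  have sq: "square R = {z. Re z \<le> R} \<inter> {z. Re z \<ge> -R} \<inter> {z. Im z \<le> R} \<inter> {z. Im z \<ge> -R}"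
    by (auto simp: square_def)
  have "winding_number c z = 0"
  proof (rule winding_number_zero_outside[OF valid_path_imp_path[OF valid] _ _ False])
    show "convex (square R)" unfolding sq
      by (intro convex_Int convex_halfspace_Re_le convex_halfspace_Re_ge convex_halfspace_Im_le convex_halfspace_Im_ge)
    show "path_image c \<subseteq> square R"
      using R by (force simp: path_image_def square_def)
  qed (simp add: closed pathstart_def pathfinish_def)
  then show ?thesis using False by (simp add: kernel_def)
qed

text \<open>The holomorphic part of the integrated Cauchy kernel drops out by Cauchy's theorem on the strip
  \<open>\<bar>Re w\<bar> < R\<close>.\<close>

lemma integral_kernel:
  assumes R: "\<And>t. t \<in> {0..1} \<Longrightarrow> \<bar>Re (c t)\<bar> < R \<and> \<bar>Im (c t)\<bar> < R"
  shows "(\<integral>t. (\<integral>z. kernel R t z \<partial>lborel) \<partial>lborel) = - 2 * pi * \<i> * integral {0..1} (\<lambda>t. Im (c t) * c' t)"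
proof -
  define h where "h = (\<lambda>w. integral {-R..R} (log_potential R w))"
  have hol: "h holomorphic_on {w. \<bar>Re w\<bar> < R}"
    unfolding h_def by (rule log_potential_integral_holomorphic)
  have im: "c ` {0..1} \<subseteq> {w. \<bar>Re w\<bar> < R}" using R by auto
  have "(h has_contour_integral 0) c"
    using Cauchy_theorem_convex_simple[OF hol convex_strip valid] im closed
    by (simp add: path_image_def pathstart_def pathfinish_def)
  then have h0: "integral {0..1} (\<lambda>t. h (c t) * c' t) = 0"
    using contour_integral_eq[of h] contour_integral_unique by metis
  have [continuous_intros]: "continuous_on {0..1} c'"
    using cont_deriv continuous_on_subset by blast
  have ch: "continuous_on {0..1} (\<lambda>t. h (c t))"
    by (rule continuous_on_compose2[OF holomorphic_on_imp_continuous_on[OF hol] cont im])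
  have co: "continuous_on {0..1} (\<lambda>t. c' t * (h (c t) - 2 * pi * \<i> * Im (c t)))"
    by (intro continuous_intros ch cont)
  have "(\<integral>t. (\<integral>z. kernel R t z \<partial>lborel) \<partial>lborel)
      = (LINT t:{0..1}|lborel. c' t * (h (c t) - 2 * pi * \<i> * Im (c t)))"
    unfolding set_lebesgue_integral_def
  proof (intro Bochner_Integration.integral_cong refl)
    fix t :: real
    have "(\<integral>z. kernel R t z \<partial>lborel)
       = (indicator {0..1} t *\<^sub>R c' t) * (\<integral>z. indicator (square R) z *\<^sub>R (1 / (c t - z)) \<partial>lborel)"
      unfolding integral_mult_right_zero[symmetric]
      by (intro Bochner_Integration.integral_cong refl) (simp add: kernel_def indicator_def)
    then show "(\<integral>z. kernel R t z \<partial>lborel)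
       = indicator {0..1} t *\<^sub>R (c' t * (h (c t) - 2 * pi * \<i> * Im (c t)))"
      using R[of t] integral_Cauchy_kernel_square[of "c t" R]
      by (cases "t \<in> {0..1}") (auto simp: h_def)
  qed
  also have "\<dots> = integral {0..1} (\<lambda>t. c' t * (h (c t) - 2 * pi * \<i> * Im (c t)))"
    by (rule set_borel_integral_eq_integral(2)[OF borel_integrable_atLeastAtMost'[OF co]])
  also have "\<dots> = integral {0..1} (\<lambda>t. h (c t) * c' t - (2 * pi * \<i>) * (Im (c t) * c' t))"
    by (simp add: algebra_simps)
  also have "\<dots> = - 2 * pi * \<i> * integral {0..1} (\<lambda>t. Im (c t) * c' t)"
    by (subst Henstock_Kurzweil_Integration.integral_diff)
       (auto simp: h0 intro!: integrable_continuous_real continuous_intros ch cont)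
  finally show ?thesis .
qed

text \<open>The image of a \<open>C\<^sup>1\<close> curve is a null set in the plane, so the winding number may be replaced
  by the kernel integral, and Fubini exchanges the two integrations.\<close>

lemma signed_area:
  "has_signed_area c (1/2 * integral {0..1} (\<lambda>t. Re (c t) * Im (c' t) - Im (c t) * Re (c' t)))"
proof -
  obtain R where R: "\<And>t. t \<in> {0..1} \<Longrightarrow> \<bar>Re (c t)\<bar> < R \<and> \<bar>Im (c t)\<bar> < R"
    using curve_in_open_square by blast
  define G where "G z = (\<integral>t. kernel R t z \<partial>lborel) / (2 * pi * \<i>)" for z
  have W: "Re (G z) = Re (winding_number c z)" if "z \<notin> path_image c" for z
    unfolding G_def using integral_kernel_curve[OF R that] by simp
  have iG: "integrable lborel (\<lambda>z. Re (G z))"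
    unfolding G_def using lborel_pair.integrable_snd[OF integrable_kernel[OF R]] by simp
  have "(\<integral>z. G z \<partial>lborel) = - integral {0..1} (\<lambda>t. Im (c t) * c' t)"
    unfolding G_def using lborel_pair.Fubini_integral[OF integrable_kernel[OF R]] integral_kernel[OF R]
    by simp
  moreover have "(\<integral>z. Re (G z) \<partial>lborel) = Re (\<integral>z. G z \<partial>lborel)"
    unfolding G_def using lborel_pair.integrable_snd[OF integrable_kernel[OF R]]
    by (intro integral_Re) simp
  moreover have "Re (integral {0..1} (\<lambda>t. Im (c t) * c' t)) = integral {0..1} (\<lambda>t. Im (c t) * Re (c' t))"
  proof -
    have "(\<lambda>t. Im (c t) * c' t) integrable_on {0..1}"
      by (auto intro!: integrable_continuous_real continuous_intros cont continuous_on_subset[OF cont_deriv])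
    then show ?thesis
      using integral_linear[OF _ bounded_linear_Re, of "\<lambda>t. Im (c t) * c' t" "{0..1}"] by (simp add: o_def)
  qed
  ultimately have I: "(\<integral>z. Re (G z) \<partial>lborel)
      = 1/2 * integral {0..1} (\<lambda>t. Re (c t) * Im (c' t) - Im (c t) * Re (c' t))"
    using area_integral_by_parts by simp
  have "(\<lambda>z. Re (G z)) absolutely_integrable_on UNIV"
    using iG by (simp add: set_integrable_def integrable_completion)
  then have 1: "(\<lambda>z. Re (winding_number c z)) absolutely_integrable_on UNIV"
    by (rule absolutely_integrable_spike[OF _ negligible_path_image]) (simp add: W)
  have 2: "integral UNIV (\<lambda>z. Re (winding_number c z)) = integral UNIV (\<lambda>z. Re (G z))"
    by (rule integral_spike[OF negligible_path_image]) (simp add: W)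
  show ?thesis
    unfolding has_signed_area_def using 1 2 integral_lborel[OF iG] I by simp
qed

end


section \<open>Calculus of smooth maps\<close>

lemma C_on_subset: "C_on k S f \<Longrightarrow> T \<subseteq> S \<Longrightarrow> C_on k T f"
  by (induction k arbitrary: f) (auto intro: continuous_on_subset)

text \<open>Above level \<open>0\<close> the recursion asks only for differentiability; the continuity at level \<open>0\<close> has to
  be extracted from it.\<close>

lemma C_on_Suc_imp: "C_on (Suc k) S f \<Longrightarrow> C_on k S f"
proof (induction k arbitrary: f)
  case 0
  then show ?case
    by (auto intro!: differentiable_imp_continuous_on differentiable_at_imp_differentiable_on)
qed auto

lemma C_on_frechet: "C_on (Suc k) S f \<Longrightarrow> C_on k S (\<lambda>x. frechet_derivative f (at x) u)"
  by simp

lemma C_on_SucI: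
  assumes "\<And>x. x \<in> S \<Longrightarrow> (f has_derivative f' x) (at x)"
    and "\<And>u. C_on k UNIV (\<lambda>x. f' x u)" and "S = UNIV"
  shows "C_on (Suc k) S f"
  using assms frechet_derivative_at[OF assms(1)] by (auto simp: differentiable_def)

lemma C_on_has_derivative:
  "C_on (Suc k) S f \<Longrightarrow> x \<in> S \<Longrightarrow> (f has_derivative frechet_derivative f (at x)) (at x)"
  by (simp add: frechet_derivative_works)

lemma C_on_const: "C_on k UNIV (\<lambda>_. c)"
proof (induction k arbitrary: c)
  case (Suc k)
  then show ?case by (intro C_on_SucI[where f' = "\<lambda>_ _. 0"]) auto
qed simp

lemma C_on_bounded_linear: "bounded_linear L \<Longrightarrow> C_on k UNIV L"
  by (cases k) (auto intro!: C_on_SucI[where f' = "\<lambda>_. L"] C_on_const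
      simp del: C_on.simps(2) simp: linear_continuous_on bounded_linear_imp_has_derivative)

lemma C_on_add: "C_on k UNIV f \<Longrightarrow> C_on k UNIV g \<Longrightarrow> C_on k UNIV (\<lambda>x. f x + g x)"
proof (induction k arbitrary: f g)
  case (Suc k)
  show ?case
    by (rule C_on_SucI[OF has_derivative_add[OF Suc.prems[THEN C_on_has_derivative]]])
       (use Suc in auto)
qed (auto intro: continuous_intros)

lemma C_on_bilinear:
  assumes "bounded_bilinear p"
  shows "C_on k UNIV f \<Longrightarrow> C_on k UNIV g \<Longrightarrow> C_on k UNIV (\<lambda>x. p (f x) (g x))"
proof (induction k arbitrary: f g)
  case 0
  then show ?case using bounded_bilinear.continuous_on[OF assms] by auto
next
  case (Suc k)
  show ?case
    by (rule C_on_SucI[OF bounded_bilinear.FDERIV[OF assms Suc.prems[THEN C_on_has_derivative]]])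
       (auto intro!: C_on_add Suc.IH C_on_frechet Suc.prems Suc.prems[THEN C_on_Suc_imp] simp del: C_on.simps)
qed

lemma C_on_compose_linear:
  assumes "bounded_linear L"
  shows "C_on k UNIV f \<Longrightarrow> C_on k UNIV (\<lambda>x. f (L x))"
proof (induction k arbitrary: f)
  case 0
  then show ?case
    using continuous_on_compose2[OF _ linear_continuous_on[OF assms]] by auto
next
  case (Suc k)
  have d: "((\<lambda>x. f (L x)) has_derivative (\<lambda>u. frechet_derivative f (at (L x)) (L u))) (at x)" for x
    using has_derivative_compose[OF bounded_linear_imp_has_derivative[OF assms] C_on_has_derivative[OF Suc.prems]]
    by simp
  show ?case
    by (rule C_on_SucI[OF d]) (auto intro: Suc.IH[OF C_on_frechet[OF Suc.prems]] simp del: C_on.simps)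
qed

text \<open>The derivative of \<open>1/\<bar>g\<bar>\<close> is \<open>- (1/\<bar>g\<bar>)\<^sup>3 (g', g)\<close>, again a product of \<open>1/\<bar>g\<bar>\<close> with smooth
  functions, so the induction closes without separate rules for roots and quotients.\<close>

lemma C_on_inverse_norm:
  fixes g :: "'a::real_normed_vector \<Rightarrow> 'b::real_inner"
  assumes "\<And>x. g x \<noteq> 0"
  shows "C_on k UNIV g \<Longrightarrow> C_on k UNIV (\<lambda>x. inverse (norm (g x)))"
proof (induction k)
  case 0
  then show ?case using assms by (auto intro!: continuous_intros)
next
  case (Suc k)
  let ?i = "\<lambda>x. inverse (norm (g x))" and ?D = "\<lambda>x. frechet_derivative g (at x)"
  have n: "((\<lambda>x. norm (g x)) has_derivative (\<lambda>u. ?D x u \<bullet> sgn (g x))) (at x)" for x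
    using has_derivative_compose[OF C_on_has_derivative[OF Suc.prems] has_derivative_norm] assms by auto
  have d: "(?i has_derivative (\<lambda>u. - (?i x * (?D x u \<bullet> sgn (g x)) * ?i x))) (at x)" for x
    by (rule Deriv.has_derivative_inverse[OF _ n]) (simp add: assms)
  have eq: "- (?i x * (?D x u \<bullet> sgn (g x)) * ?i x) = (-1) * (?i x * (?i x * (?i x * (?D x u \<bullet> g x))))" for x u
    by (simp add: sgn_div_norm)
  have "C_on k UNIV ?i" using Suc C_on_Suc_imp by blast
  then show ?case
    by (intro C_on_SucI[OF d], subst eq)
       (intro C_on_bilinear[OF bounded_bilinear_mult] C_on_bilinear[OF bounded_bilinear_inner]
          C_on_const C_on_frechet Suc.prems Suc.prems[THEN C_on_Suc_imp], auto)
qed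

lemma smooth_on_subset: "smooth_on S f \<Longrightarrow> T \<subseteq> S \<Longrightarrow> smooth_on T f"
  by (auto simp: smooth_on_def intro: C_on_subset)

lemma smooth_on_has_derivative:
  "smooth_on S f \<Longrightarrow> x \<in> S \<Longrightarrow> (f has_derivative frechet_derivative f (at x)) (at x)"
  unfolding smooth_on_def using C_on_has_derivative by blast

lemma smooth_on_frechet: "smooth_on S f \<Longrightarrow> smooth_on S (\<lambda>x. frechet_derivative f (at x) u)"
  unfolding smooth_on_def using C_on_frechet by blast

lemma smooth_on_continuous_on: "smooth_on UNIV f \<Longrightarrow> continuous_on S f"
  unfolding smooth_on_def by (metis C_on.simps(1) continuous_on_subset subset_UNIV)

lemma smooth_on_const: "smooth_on UNIV (\<lambda>_. c)"
  and smooth_on_bounded_linear: "bounded_linear L \<Longrightarrow> smooth_on UNIV L"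
  and smooth_on_add: "smooth_on UNIV f \<Longrightarrow> smooth_on UNIV g \<Longrightarrow> smooth_on UNIV (\<lambda>x. f x + g x)"
  and smooth_on_bilinear: "bounded_bilinear p \<Longrightarrow> smooth_on UNIV h \<Longrightarrow> smooth_on UNIV k
      \<Longrightarrow> smooth_on UNIV (\<lambda>x. p (h x) (k x))"
  and smooth_on_compose_linear: "bounded_linear M \<Longrightarrow> smooth_on UNIV h \<Longrightarrow> smooth_on UNIV (\<lambda>x. h (M x))"
  by (simp_all add: smooth_on_def C_on_const C_on_bounded_linear C_on_add C_on_bilinear C_on_compose_linear)

lemma smooth_on_diff:
  assumes "smooth_on UNIV f" "smooth_on UNIV g"
  shows "smooth_on UNIV (\<lambda>x. f x - g x)"
  using smooth_on_add[OF assms(1) smooth_on_bilinear[OF bounded_bilinear_scaleR smooth_on_const[of "-1"] assms(2)]]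
  by simp

lemma smooth_on_inverse_norm:
  fixes g :: "'a::real_normed_vector \<Rightarrow> 'b::real_inner"
  shows "smooth_on UNIV g \<Longrightarrow> (\<And>x. g x \<noteq> 0) \<Longrightarrow> smooth_on UNIV (\<lambda>x. inverse (norm (g x)))"
  by (simp add: smooth_on_def C_on_inverse_norm)

lemma smooth_on_has_vector_derivative:
  fixes f :: "real \<Rightarrow> 'a::real_normed_vector"
  shows "smooth_on UNIV f \<Longrightarrow> (f has_vector_derivative vector_derivative f (at s)) (at s)"
  by (meson UNIV_I differentiable_def smooth_on_has_derivative vector_derivative_works)

lemma smooth_on_vector_derivative:
  fixes f :: "real \<Rightarrow> 'a::real_normed_vector"
  assumes "smooth_on UNIV f"
  shows "smooth_on UNIV (\<lambda>s. vector_derivative f (at s))"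
proof -
  have "vector_derivative f (at s) = frechet_derivative f (at s) 1" for s
    by (metis assms frechet_derivative_at has_vector_derivative_def scaleR_one smooth_on_has_vector_derivative)
  then show ?thesis using smooth_on_frechet[OF assms, of 1] by simp
qed

lemma bounded_bilinear_cross3: "bounded_bilinear cross3"
  using bilinear_cross bilinear_conv_bounded_bilinear by blast


section \<open>Translations of the line\<close>

text \<open>If some point above \<open>a\<close> were missing from \<open>Z\<close>, consider the infimum \<open>m\<close> of the missing points.
  A missing point below \<open>\<sigma> m\<close> has its preimage in \<open>[a, m)\<close>, hence in \<open>Z\<close>, which contradicts invariance.
  Below \<open>a\<close> the same argument applies to the supremum.\<close>

lemma invariant_set_UNIV:
  fixes \<sigma> :: "real \<Rightarrow> real"
  assumes mono: "strict_mono \<sigma>" and surj: "surj \<sigma>" and gt: "\<And>s. s < \<sigma> s"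
    and Z: "\<And>s. \<sigma> s \<in> Z \<longleftrightarrow> s \<in> Z" and a: "{a..\<sigma> a} \<subseteq> Z"
  shows "Z = UNIV"
proof -
  have up: "x \<in> Z" if x: "a \<le> x" for x
  proof (rule ccontr)
    assume "x \<notin> Z"
    define B where "B = {x. a \<le> x \<and> x \<notin> Z}"
    have B: "B \<noteq> {}" "bdd_below B" using x \<open>x \<notin> Z\<close> by (auto simp: B_def)
    obtain y where y: "y \<in> B" "y < \<sigma> (Inf B)"
      using cInf_less_iff[OF B, of "\<sigma> (Inf B)"] gt by blast
    obtain u where u: "y = \<sigma> u" using surj by (auto simp: surj_def)
    have "u < Inf B" using y(2) mono by (simp add: u strict_mono_less)
    moreover have "\<sigma> a \<le> y" using y a by (force simp: B_def)
    then have "a \<le> u" using mono by (simp add: u strict_mono_less_eq)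
    ultimately have "u \<in> Z"
      using cInf_lower[OF _ B(2), of u] by (force simp: B_def)
    then show False using y Z by (simp add: u B_def)
  qed
  have down: "x \<in> Z" if x: "x \<le> a" for x
  proof (rule ccontr)
    assume "x \<notin> Z"
    define B where "B = {x. x \<le> a \<and> x \<notin> Z}"
    have B: "B \<noteq> {}" "bdd_above B" using x \<open>x \<notin> Z\<close> by (auto simp: B_def)
    obtain u where u: "Sup B = \<sigma> u" using surj by (auto simp: surj_def)
    have "u < Sup B" using gt u by simp
    then obtain y where y: "y \<in> B" "u < y"
      using less_cSup_iff[OF B, of u] by blast
    have "Sup B < \<sigma> y" using y(2) mono by (simp add: u strict_mono_less)
    then have "\<sigma> y \<notin> B" using cSup_upper[OF _ B(2)] by force
    moreover have "\<sigma> y \<notin> Z" using y Z by (simp add: B_def)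
    ultimately have "a < \<sigma> y" by (auto simp: B_def)
    then show False using up[of "\<sigma> y"] \<open>\<sigma> y \<notin> Z\<close> by simp
  qed
  show ?thesis using up down by (metis UNIV_eq_I linear)
qed

locale translation =
  fixes \<tau> :: "real \<Rightarrow> real"
  assumes diffeo: "translation_diffeo \<tau>"
begin

definition dtau :: "real \<Rightarrow> real" where "dtau s = vector_derivative \<tau> (at s)"

lemma smooth: "smooth_on UNIV \<tau>" and bij: "bij \<tau>" and no_fix: "\<tau> s \<noteq> s"
  using diffeo by (auto simp: translation_diffeo_def)

lemma deriv: "(\<tau> has_real_derivative dtau s) (at s)"
  using smooth_on_has_vector_derivative[OF smooth]
  by (simp add: dtau_def has_real_derivative_iff_has_vector_derivative)

lemma continuous: "continuous_on S \<tau>"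
  by (rule smooth_on_continuous_on[OF smooth])

lemma same_direction: "s < \<tau> s \<longleftrightarrow> t < \<tau> t"
proof -
  have *: False if "s < \<tau> s" "\<tau> t < t" for s t
  proof -
    have "connected (range (\<lambda>s. \<tau> s - s))"
      by (intro connected_continuous_image continuous_intros continuous) simp
    then have "0 \<in> range (\<lambda>s. \<tau> s - s)"
      using connectedD_interval[of _ "\<tau> t - t" "\<tau> s - s" 0] that by auto
    then show False using no_fix by (auto simp: image_def)
  qed
  show ?thesis using * no_fix by (metis linorder_neqE)
qed

text \<open>The derivative vanishes nowhere because the inverse is differentiable too, so its sign is
  constant. A decreasing map would move \<open>s\<close> and \<open>\<tau> s\<close> in opposite directions.\<close>

lemma dtau_pos: "dtau s > 0"
proof -
  have nz: "dtau s \<noteq> 0" for s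
  proof
    assume 0: "dtau s = 0"
    have "smooth_on UNIV (inv \<tau>)" using diffeo by (simp add: translation_diffeo_def)
    then have i: "(inv \<tau> has_real_derivative vector_derivative (inv \<tau>) (at (\<tau> s))) (at (\<tau> s))"
      using smooth_on_has_vector_derivative by (simp add: has_real_derivative_iff_has_vector_derivative)
    have "((\<lambda>x. inv \<tau> (\<tau> x)) has_real_derivative vector_derivative (inv \<tau>) (at (\<tau> s)) * dtau s) (at s)"
      by (rule DERIV_chain2[OF i deriv])
    then have "((\<lambda>x. x) has_real_derivative 0) (at s)"
      using bij by (simp add: 0 bij_is_inj)
    then show False using DERIV_unique[OF DERIV_ident] by fastforce
  qed
  show ?thesis
  proof (rule ccontr)
    assume s: "\<not> dtau s > 0"
    have "continuous_on UNIV dtau"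
      unfolding dtau_def by (rule smooth_on_continuous_on[OF smooth_on_vector_derivative[OF smooth]])
    then have con: "connected (range dtau)"
      by (intro connected_continuous_image) auto
    have "dtau t < 0" for t
      using connectedD_interval[OF con, of "dtau s" "dtau t" 0] s nz
      by (metis image_iff linorder_less_linear not_less_iff_gr_or_eq order_less_imp_le rangeI)
    then have dec: "x < y \<Longrightarrow> \<tau> y < \<tau> x" for x y
      using DERIV_neg_imp_decreasing[of x y \<tau>] deriv by blast
    consider "s < \<tau> s" | "\<tau> s < s" using no_fix by (metis linorder_neqE)
    then show False
    proof cases
      case 1 then show ?thesis using dec[OF 1] same_direction[of s "\<tau> s"] by simp
    next
      case 2 then show ?thesis using dec[OF 2] same_direction[of s "\<tau> s"] by simp
    qed
  qed
qed

lemma strict_mono: "strict_mono \<tau>"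
  using DERIV_pos_imp_increasing[of _ _ \<tau>] deriv dtau_pos by (metis strict_monoI)

lemma fundamental_domain_cases:
  assumes "fundamental_domain \<tau> I"
  obtains lo hi where "lo < hi" "I = {lo..hi}" "hi = \<tau> lo \<or> lo = \<tau> hi"
proof -
  obtain s where s: "I = closed_segment s (\<tau> s)" using assms by (auto simp: fundamental_domain_def)
  show ?thesis
    using that[of s "\<tau> s"] that[of "\<tau> s" s] no_fix[of s] s
    by (auto simp: closed_segment_eq_real_ivl split: if_splits)
qed

text \<open>The translates of a fundamental domain cover the line. When \<open>\<tau>\<close> moves points down, its inverse
  moves them up and has the same invariant sets.\<close>

lemma invariant_property_everywhere:
  assumes I: "fundamental_domain \<tau> I" and inv: "\<And>s. P (\<tau> s) \<longleftrightarrow> P s" and "\<And>s. s \<in> I \<Longrightarrow> P s"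
  shows "P s"
proof -
  obtain lo hi where lh: "lo < hi" "I = {lo..hi}" "hi = \<tau> lo \<or> lo = \<tau> hi"
    using fundamental_domain_cases[OF I] .
  have surj: "surj \<tau>" using bij by (rule bij_is_surj)
  have "{s. P s} = UNIV"
  proof (cases "hi = \<tau> lo")
    case True
    then have "t < \<tau> t" for t using lh same_direction[of lo t] by simp
    then show ?thesis
      using True lh assms by (intro invariant_set_UNIV[OF strict_mono surj, of _ lo]) auto
  next
    case False
    then have lo: "lo = \<tau> hi" using lh by simp
    then have lt: "\<tau> t < t" for t using lh same_direction[of hi t] no_fix[of t] by simp
    have inv_id: "\<tau> (inv \<tau> t) = t" "inv \<tau> (\<tau> t) = t" for t
      using bij by (simp_all add: bij_is_inj surj_f_inv_f surj)
    show ?thesis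
    proof (rule invariant_set_UNIV[of "inv \<tau>" _ lo])
      show "strict_mono (inv \<tau>)"
        using strict_mono inv_id by (metis strict_monoI strict_mono_less)
      show "surj (inv \<tau>)" using bij bij_imp_bij_inv bij_is_surj by blast
      show "s < inv \<tau> s" for s using lt[of "inv \<tau> s"] inv_id by simp
      show "inv \<tau> s \<in> {s. P s} \<longleftrightarrow> s \<in> {s. P s}" for s using inv[of "inv \<tau> s"] inv_id by simp
      show "{lo..inv \<tau> lo} \<subseteq> {s. P s}" using assms(3) lh lo inv_id by auto
    qed
  qed
  then show ?thesis by auto
qed

lemma equivariant_derivative:
  fixes f :: "real \<Rightarrow> real^3"
  assumes f: "smooth_on UNIV f" and eq: "\<And>s. f (\<tau> s) = A *v f s + a"
  shows "dtau s *\<^sub>R vector_derivative f (at (\<tau> s)) = A *v vector_derivative f (at s)"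
proof -
  have 1: "((\<lambda>s. f (\<tau> s)) has_vector_derivative dtau s *\<^sub>R vector_derivative f (at (\<tau> s))) (at s)"
    using vector_diff_chain_at[OF _ smooth_on_has_vector_derivative[OF f], of \<tau> "dtau s" s] deriv[of s]
    by (simp add: has_real_derivative_iff_has_vector_derivative o_def)
  have "((\<lambda>s. A *v f s) has_vector_derivative A *v vector_derivative f (at s)) (at s)"
    by (rule bounded_linear.has_vector_derivative[OF _ smooth_on_has_vector_derivative[OF f]]) simp
  then have "((\<lambda>s. A *v f s + a) has_vector_derivative A *v vector_derivative f (at s)) (at s)"
    by (simp add: has_vector_derivative_add_const)
  with 1 show ?thesis
    unfolding eq using vector_derivative_unique_at by blast
qed

end


section \<open>Curves with monodromy\<close>

lemmas smooth_intros = smooth_on_const smooth_on_add smooth_on_diff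
  smooth_on_bilinear[OF bounded_bilinear_scaleR] smooth_on_bilinear[OF bounded_bilinear_cross3]
  smooth_on_bilinear[OF bounded_bilinear_inner]

lemma has_vector_derivative_cross3:
  assumes "(f has_vector_derivative f') (at s)" "(g has_vector_derivative g') (at s)"
  shows "((\<lambda>s. cross3 (f s) (g s)) has_vector_derivative cross3 (f s) g' + cross3 f' (g s)) (at s)"
  by (rule bounded_bilinear.has_vector_derivative[OF bounded_bilinear_cross3 assms])

lemma has_vector_derivative_quotient:
  fixes f :: "real \<Rightarrow> 'a::real_normed_vector"
  assumes "(f has_vector_derivative d) (at 0)"
  shows "((\<lambda>t. (f t - f 0) /\<^sub>R t) \<longlongrightarrow> d) (at 0)"
proof -
  have "((\<lambda>t. norm (f t - f 0 - t *\<^sub>R d) / norm t) \<longlongrightarrow> 0) (at 0)"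
    using assms by (simp add: has_vector_derivative_def has_derivative_iff_norm)
  moreover have "\<forall>\<^sub>F t in at (0::real). norm (f t - f 0 - t *\<^sub>R d) / norm t = norm ((f t - f 0) /\<^sub>R t - d)"
  proof (rule eventually_at_ball'[THEN eventually_mono])
    show "(0::real) < 1" by simp
    fix t :: real assume "t \<in> ball 0 1 \<and> t \<noteq> 0 \<and> t \<in> UNIV"
    then have "(f t - f 0) /\<^sub>R t - d = (f t - f 0 - t *\<^sub>R d) /\<^sub>R t"
      by (simp add: scaleR_diff_right)
    then show "norm (f t - f 0 - t *\<^sub>R d) / norm t = norm ((f t - f 0) /\<^sub>R t - d)"
      by (simp only: norm_scaleR real_norm_def abs_inverse divide_inverse mult.commute)
  qed
  ultimately have "((\<lambda>t. norm ((f t - f 0) /\<^sub>R t - d)) \<longlongrightarrow> 0) (at 0)"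
    by (rule Lim_transform_eventually)
  then show ?thesis by (rule LIM_zero_cancel[OF tendsto_norm_zero_cancel])
qed

lemma norm_cross3_le: "norm (cross3 x y) \<le> norm x * norm y"
  by (rule power2_le_imp_le) (use norm_cross_dot[of x y] in \<open>simp_all add: add_increasing2 flip: norm_cross_dot\<close>)

locale monodromy_setting = translation \<tau> for \<tau> +
  fixes I :: "real set" and A :: "real^3^3" and a v :: "real^3"
  assumes fd: "fundamental_domain \<tau> I" and rot: "rotation_matrix A"
    and v: "A *v v = v" and a: "a \<in> span {v}"
begin

lemma A_cross: "cross3 (A *v x) (A *v y) = A *v cross3 x y"
  by (rule cross_rotation_matrix[OF rot])

lemma A_inner: "(A *v x) \<bullet> (A *v y) = x \<bullet> y"
proof -
  have "orthogonal_transformation (\<lambda>x. A *v x)"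
    using rot by (simp add: orthogonal_transformation_matrix rotation_matrix_def)
  then show ?thesis by (simp add: orthogonal_transformation_def)
qed

lemma A_norm: "norm (A *v x) = norm x"
  by (simp add: norm_eq_sqrt_inner A_inner)

lemma a_cross_v: "cross3 a x \<bullet> v = 0" "cross3 x a \<bullet> v = 0"
  using a by (auto simp: span_singleton cross_mult_left cross_mult_right dot_cross_self)

lemma curve_smooth: "\<gamma> \<in> curves \<tau> A a \<Longrightarrow> smooth_on UNIV \<gamma>"
  and curve_immersed: "\<gamma> \<in> curves \<tau> A a \<Longrightarrow> vector_derivative \<gamma> (at s) \<noteq> 0"
  and curve_tau: "\<gamma> \<in> curves \<tau> A a \<Longrightarrow> \<gamma> (\<tau> s) = A *v \<gamma> s + a"
  by (auto simp: curves_def monodromy_def)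

lemma curve_deriv: "\<gamma> \<in> curves \<tau> A a \<Longrightarrow> (\<gamma> has_vector_derivative vector_derivative \<gamma> (at s)) (at s)"
  by (rule smooth_on_has_vector_derivative[OF curve_smooth])

lemma curve_deriv_continuous: "\<gamma> \<in> curves \<tau> A a \<Longrightarrow> continuous_on S (\<lambda>s. vector_derivative \<gamma> (at s))"
  by (rule smooth_on_continuous_on[OF smooth_on_vector_derivative[OF curve_smooth]])

lemma curve_continuous: "\<gamma> \<in> curves \<tau> A a \<Longrightarrow> continuous_on S \<gamma>"
  by (rule smooth_on_continuous_on[OF curve_smooth])

lemma speed_pos: "\<gamma> \<in> curves \<tau> A a \<Longrightarrow> speed \<gamma> s > 0"
  using curve_immersed by (simp add: speed_def)

lemma speed_continuous: "\<gamma> \<in> curves \<tau> A a \<Longrightarrow> continuous_on S (speed \<gamma>)"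
  unfolding speed_def by (intro continuous_intros curve_deriv_continuous)

lemma unit_tangent_smooth:
  assumes "\<gamma> \<in> curves \<tau> A a"
  shows "smooth_on UNIV (unit_tangent \<gamma>)"
proof -
  have s: "smooth_on UNIV (\<lambda>s. vector_derivative \<gamma> (at s))"
    by (rule smooth_on_vector_derivative[OF curve_smooth[OF assms]])
  have "smooth_on UNIV (\<lambda>s. inverse (norm (vector_derivative \<gamma> (at s))) *\<^sub>R vector_derivative \<gamma> (at s))"
    by (intro smooth_intros smooth_on_inverse_norm s curve_immersed[OF assms])
  then show ?thesis by (simp add: unit_tangent_def[abs_def] arclength_derivative_def[abs_def] speed_def)
qed

lemma unit_tangent_tau:
  assumes "\<gamma> \<in> curves \<tau> A a"
  shows "unit_tangent \<gamma> (\<tau> s) = A *v unit_tangent \<gamma> s"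
proof -
  let ?d = "\<lambda>s. vector_derivative \<gamma> (at s)"
  have d: "dtau s *\<^sub>R ?d (\<tau> s) = A *v ?d s"
    by (rule equivariant_derivative[OF curve_smooth[OF assms] curve_tau[OF assms]])
  then have "norm (A *v ?d s) = norm (dtau s *\<^sub>R ?d (\<tau> s))" by simp
  then have n: "norm (?d s) = dtau s * norm (?d (\<tau> s))"
    using dtau_pos[of s] by (simp add: A_norm)
  have "A *v (?d s /\<^sub>R norm (?d s)) = (dtau s *\<^sub>R ?d (\<tau> s)) /\<^sub>R norm (?d s)"
    by (simp add: matrix_vector_mult_scaleR d)
  also have "\<dots> = ?d (\<tau> s) /\<^sub>R norm (?d (\<tau> s))"
    using dtau_pos[of s] by (simp add: n)
  finally show ?thesis by (simp add: unit_tangent_def arclength_derivative_def speed_def)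
qed

lemma unit_tangent_norm: "\<gamma> \<in> curves \<tau> A a \<Longrightarrow> unit_tangent \<gamma> s \<bullet> unit_tangent \<gamma> s = 1"
  using curve_immersed[of \<gamma> s]
  by (simp add: unit_tangent_def arclength_derivative_def speed_def power2_norm_eq_inner[symmetric]
      power2_eq_square)

lemma speed_unit_tangent: "\<gamma> \<in> curves \<tau> A a \<Longrightarrow> speed \<gamma> s *\<^sub>R unit_tangent \<gamma> s = vector_derivative \<gamma> (at s)"
  using speed_pos[of \<gamma> s] by (simp add: unit_tangent_def arclength_derivative_def)

lemma tangent_smooth: "\<xi> \<in> tangent_space \<tau> A \<Longrightarrow> smooth_on UNIV \<xi>"
  and tangent_tau: "\<xi> \<in> tangent_space \<tau> A \<Longrightarrow> \<xi> (\<tau> s) = A *v \<xi> s"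
  by (auto simp: tangent_space_def)

lemma unit_tangent_in: "\<gamma> \<in> curves \<tau> A a \<Longrightarrow> unit_tangent \<gamma> \<in> tangent_space \<tau> A"
  by (simp add: tangent_space_def unit_tangent_smooth unit_tangent_tau)

lemma const_in: "(\<lambda>s. v) \<in> tangent_space \<tau> A"
  by (simp add: tangent_space_def smooth_on_const v)

lemma cross_in:
  "\<xi> \<in> tangent_space \<tau> A \<Longrightarrow> \<eta> \<in> tangent_space \<tau> A \<Longrightarrow> (\<lambda>s. cross3 (\<xi> s) (\<eta> s)) \<in> tangent_space \<tau> A"
  and diff_in:
  "\<xi> \<in> tangent_space \<tau> A \<Longrightarrow> \<eta> \<in> tangent_space \<tau> A \<Longrightarrow> (\<lambda>s. \<xi> s - \<eta> s) \<in> tangent_space \<tau> A"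
  by (auto simp: tangent_space_def A_cross matrix_vector_mult_diff_distrib intro!: smooth_intros)

text \<open>The end points of a fundamental domain correspond under \<open>\<tau>\<close>, whichever of them is the larger
  one, so the boundary terms cancel.\<close>

lemma integral_derivative_invariant:
  assumes b: "\<And>s. (b has_real_derivative b' s) (at s)" and inv: "\<And>s. b (\<tau> s) = b s"
  shows "(b' has_integral 0) I"
proof -
  obtain lo hi where lh: "lo < hi" "I = {lo..hi}" "hi = \<tau> lo \<or> lo = \<tau> hi"
    using fundamental_domain_cases[OF fd] .
  have "(b' has_integral b hi - b lo) {lo..hi}"
    using lh b by (intro fundamental_theorem_of_calculus)
      (auto simp flip: has_real_derivative_iff_has_vector_derivative intro: has_field_derivative_at_within)
  then show ?thesis using lh inv by auto
qed

lemma fd_compact: "\<exists>lo hi. I = cbox lo (hi::real)"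
  using fundamental_domain_cases[OF fd] by (metis interval_cbox)

lemma integrable_I: "continuous_on I (f :: real \<Rightarrow> real) \<Longrightarrow> f integrable_on I"
  using fd_compact integrable_continuous by blast


section \<open>The differential\<close>

text \<open>The integrand on the right differs from the difference of the two integrands of \<open>E\<close> by the
  derivative of \<open>(\<gamma> \<times> \<beta>, v)\<close>, which is invariant under \<open>\<tau>\<close> and hence contributes no boundary term.\<close>

lemma E_difference:
  assumes \<gamma>: "\<gamma> \<in> curves \<tau> A a" and \<beta>: "\<beta> \<in> curves \<tau> A a"
  shows "E_minus_1 I v \<beta> - E_minus_1 I v \<gamma> = 1/2 * integral I
    (\<lambda>s. cross3 (\<beta> s - \<gamma> s) (vector_derivative \<gamma> (at s) + vector_derivative \<beta> (at s)) \<bullet> v)"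
proof -
  let ?g = "\<lambda>s. vector_derivative \<gamma> (at s)" and ?b = "\<lambda>s. vector_derivative \<beta> (at s)"
  let ?B = "\<lambda>s. (cross3 (\<gamma> s) (?b s) + cross3 (?g s) (\<beta> s)) \<bullet> v"
  have 0: "(?B has_integral 0) I"
  proof (rule integral_derivative_invariant[where b = "\<lambda>s. cross3 (\<gamma> s) (\<beta> s) \<bullet> v"])
    show "((\<lambda>s. cross3 (\<gamma> s) (\<beta> s) \<bullet> v) has_real_derivative ?B s) (at s)" for s
      using bounded_linear.has_vector_derivative[OF bounded_linear_inner_left
          has_vector_derivative_cross3[OF curve_deriv[OF \<gamma>] curve_deriv[OF \<beta>]]]
      by (simp add: has_real_derivative_iff_has_vector_derivative)
    show "cross3 (\<gamma> (\<tau> s)) (\<beta> (\<tau> s)) \<bullet> v = cross3 (\<gamma> s) (\<beta> s) \<bullet> v" for s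
    proof -
      have "cross3 (\<gamma> (\<tau> s)) (\<beta> (\<tau> s)) \<bullet> v = (A *v cross3 (\<gamma> s) (\<beta> s)) \<bullet> v"
        by (simp add: curve_tau \<gamma> \<beta> cross_add_left cross_add_right inner_add_left a_cross_v A_cross)
      also have "\<dots> = (A *v cross3 (\<gamma> s) (\<beta> s)) \<bullet> (A *v v)" by (simp add: v)
      finally show ?thesis by (simp only: A_inner)
    qed
  qed
  note [continuous_intros] = continuous_on_cross curve_continuous[OF \<gamma>] curve_continuous[OF \<beta>]
    curve_deriv_continuous[OF \<gamma>] curve_deriv_continuous[OF \<beta>]
  have "integral I (\<lambda>s. cross3 (\<beta> s - \<gamma> s) (?g s + ?b s) \<bullet> v)
     = integral I (\<lambda>s. (cross3 (\<beta> s) (?b s) \<bullet> v - cross3 (\<gamma> s) (?g s) \<bullet> v) - ?B s)"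
  proof (rule integral_cong)
    fix s
    have "cross3 (?g s) (\<beta> s) = - cross3 (\<beta> s) (?g s)" by (rule cross_skew)
    then show "cross3 (\<beta> s - \<gamma> s) (?g s + ?b s) \<bullet> v
       = (cross3 (\<beta> s) (?b s) \<bullet> v - cross3 (\<gamma> s) (?g s) \<bullet> v) - ?B s"
      by (simp add: Cross3.left_diff_distrib cross_add_right inner_diff_left inner_add_left)
  qed
  also have "\<dots> = integral I (\<lambda>s. cross3 (\<beta> s) (?b s) \<bullet> v) - integral I (\<lambda>s. cross3 (\<gamma> s) (?g s) \<bullet> v) - integral I ?B"
  proof -
    have "(\<lambda>s. cross3 (\<beta> s) (?b s) \<bullet> v) integrable_on I" "(\<lambda>s. cross3 (\<gamma> s) (?g s) \<bullet> v) integrable_on I"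
      by (intro integrable_I continuous_intros)+
    with has_integral_integrable[OF 0] show ?thesis
      by (simp add: Henstock_Kurzweil_Integration.integral_diff integrable_diff)
  qed
  finally show ?thesis using integral_unique[OF 0] by (simp add: E_minus_1_def)
qed

text \<open>The speed in the metric cancels the one in the unit tangent.\<close>

lemma L2_unit_tangent_cross:
  assumes "\<gamma> \<in> curves \<tau> A a"
  shows "L2_metric I \<gamma> (\<lambda>s. cross3 (unit_tangent \<gamma> s) v) \<xi>
    = integral I (\<lambda>s. cross3 (\<xi> s) (vector_derivative \<gamma> (at s)) \<bullet> v)"
  unfolding L2_metric_def
proof (rule integral_cong)
  fix s
  have "cross3 (unit_tangent \<gamma> s) v \<bullet> \<xi> s * speed \<gamma> s = cross3 (speed \<gamma> s *\<^sub>R unit_tangent \<gamma> s) v \<bullet> \<xi> s"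
    by (simp add: cross_mult_left)
  also have "\<dots> = cross3 (vector_derivative \<gamma> (at s)) v \<bullet> \<xi> s"
    by (simp only: speed_unit_tangent[OF assms])
  also have "\<dots> = cross3 (\<xi> s) (vector_derivative \<gamma> (at s)) \<bullet> v"
    by (simp add: cross3_simps)
  finally show "cross3 (unit_tangent \<gamma> s) v \<bullet> \<xi> s * speed \<gamma> s = cross3 (\<xi> s) (vector_derivative \<gamma> (at s)) \<bullet> v" .
qed

text \<open>Through this identity every statement about symplectic gradients becomes one about the metric.\<close>

lemma presymplectic_eq_L2:
  "presymplectic I \<gamma> \<xi> = L2_metric I \<gamma> (\<lambda>s. cross3 (unit_tangent \<gamma> s) (\<xi> s))"
  unfolding presymplectic_def L2_metric_def fun_eq_iff
  by (intro allI integral_cong) (simp add: dot_cross_det[symmetric] cross3_simps)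

text \<open>In the difference formula \<open>(\<Gamma> t - \<gamma>)/t\<close> converges to \<open>\<xi>\<close> pointwise and is bounded by the mean
  value inequality, while \<open>\<Gamma> t'\<close> converges to \<open>\<gamma>'\<close> because the variation is jointly \<open>C\<^sup>1\<close>. Dominated
  convergence gives the derivative.\<close>

lemma differential_E:
  assumes \<gamma>: "\<gamma> \<in> curves \<tau> A a"
  shows "has_differential \<tau> A a (E_minus_1 I v) \<gamma> (L2_metric I \<gamma> (\<lambda>s. cross3 (unit_tangent \<gamma> s) v))"
  unfolding has_differential_def
proof (intro ballI allI impI)
  fix \<xi> \<Gamma> assume \<xi>: "\<xi> \<in> tangent_space \<tau> A" and "variation \<tau> A a \<gamma> \<xi> \<Gamma>"
  then obtain \<epsilon> where \<epsilon>: "\<epsilon> > 0" and sm: "smooth_on ({-\<epsilon><..<\<epsilon>} \<times> UNIV) (\<lambda>(t, s). \<Gamma> t s)"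
    and cu: "\<And>t. t \<in> {-\<epsilon><..<\<epsilon>} \<Longrightarrow> \<Gamma> t \<in> curves \<tau> A a" and \<Gamma>0: "\<Gamma> 0 = \<gamma>"
    and var: "\<And>s. ((\<lambda>t. \<Gamma> t s) has_vector_derivative \<xi> s) (at 0)"
    by (auto simp: variation_def)
  define F where "F = (\<lambda>p. \<Gamma> (fst p) (snd p))"
  define D where "D u p = frechet_derivative F (at p) u" for u p
  let ?S = "{-\<epsilon><..<\<epsilon>} \<times> (UNIV :: real set)"
  have smF: "smooth_on ?S F" using sm by (simp add: F_def case_prod_unfold)
  have dF: "(F has_derivative (\<lambda>u. D u p)) (at p)" if "p \<in> ?S" for p
    unfolding D_def by (rule smooth_on_has_derivative[OF smF that])
  have cD: "continuous_on ?S (D u)" for u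
    using smooth_on_frechet[OF smF, of u] unfolding D_def smooth_on_def by (metis C_on.simps(1))
  \<comment> \<open>The two partial derivatives of the variation are read off from its total derivative.\<close>
  have dt: "((\<lambda>t. \<Gamma> t s) has_derivative (\<lambda>h. h *\<^sub>R D (1, 0) (t, s))) (at t)" if "t \<in> {-\<epsilon><..<\<epsilon>}" for t s
  proof -
    have ts: "(t, s) \<in> ?S" using that by simp
    have "((\<lambda>t. F (t, s)) has_derivative (\<lambda>h. D (h *\<^sub>R (1, 0)) (t, s))) (at t)"
    proof (rule has_derivative_compose[OF _ dF])
      show "((\<lambda>t. (t, s)) has_derivative (\<lambda>h. h *\<^sub>R (1, 0))) (at t)"
        by (rule has_derivative_eq_rhs[OF has_derivative_Pair[OF has_derivative_ident has_derivative_const]]) auto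
    qed (use that in auto)
    moreover have "(\<lambda>h. D (h *\<^sub>R (1, 0)) (t, s)) = (\<lambda>h. h *\<^sub>R D (1, 0) (t, s))"
      by (intro ext linear_scale[OF has_derivative_linear[OF dF[OF ts]]])
    ultimately show ?thesis by (simp only: F_def fst_conv snd_conv)
  qed
  have ds: "vector_derivative (\<Gamma> t) (at s) = D (0, 1) (t, s)" if "t \<in> {-\<epsilon><..<\<epsilon>}" for t s
  proof -
    have ts: "(t, s) \<in> ?S" using that by simp
    have "((\<lambda>s. F (t, s)) has_derivative (\<lambda>h. D (h *\<^sub>R (0, 1)) (t, s))) (at s)"
    proof (rule has_derivative_compose[OF _ dF])
      show "((\<lambda>s. (t, s)) has_derivative (\<lambda>h. h *\<^sub>R (0, 1))) (at s)"
        by (rule has_derivative_eq_rhs[OF has_derivative_Pair[OF has_derivative_const has_derivative_ident]]) auto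
    qed (use that in auto)
    moreover have "(\<lambda>h. D (h *\<^sub>R (0, 1)) (t, s)) = (\<lambda>h. h *\<^sub>R D (0, 1) (t, s))"
      by (intro ext linear_scale[OF has_derivative_linear[OF dF[OF ts]]])
    ultimately have "(\<Gamma> t has_vector_derivative D (0, 1) (t, s)) (at s)"
      by (simp only: F_def fst_conv snd_conv has_vector_derivative_def)
    then show ?thesis by (rule vector_derivative_at)
  qed
  \<comment> \<open>A compact parameter interval around \<open>0\<close>, on which the first derivatives are bounded.\<close>
  let ?J = "{-\<epsilon>/2..\<epsilon>/2}"
  have J: "?J \<subseteq> {-\<epsilon><..<\<epsilon>}" using \<epsilon> by auto
  have "compact (?J \<times> I)" using fd_compact by (metis compact_Times compact_cbox compact_Icc)
  then have "bounded (D u ` (?J \<times> I))" for u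
    using J by (intro compact_imp_bounded compact_continuous_image continuous_on_subset[OF cD]) auto
  then have "\<exists>K. \<forall>t\<in>?J. \<forall>s\<in>I. norm (D u (t, s)) \<le> K" for u
    unfolding bounded_iff by blast
  then obtain K L where K: "\<And>t s. t \<in> ?J \<Longrightarrow> s \<in> I \<Longrightarrow> norm (D (1, 0) (t, s)) \<le> K"
    and L: "\<And>t s. t \<in> ?J \<Longrightarrow> s \<in> I \<Longrightarrow> norm (D (0, 1) (t, s)) \<le> L"
    by metis
  have lip: "norm (\<Gamma> t s - \<gamma> s) \<le> K * \<bar>t\<bar>" if "t \<in> ?J" "s \<in> I" for t s
  proof -
    have "norm (\<Gamma> t s - \<Gamma> 0 s) \<le> K * norm (t - 0)"
    proof (rule differentiable_bound[where S = ?J])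
      fix x assume x: "x \<in> ?J"
      show "((\<lambda>t. \<Gamma> t s) has_derivative (\<lambda>h. h *\<^sub>R D (1, 0) (x, s))) (at x within ?J)"
        using x J by (intro has_derivative_at_withinI[OF dt]) auto
      show "onorm (\<lambda>h. h *\<^sub>R D (1, 0) (x, s)) \<le> K"
        using K[OF x that(2)] by (intro onorm_le) (simp add: mult.commute[of K] mult_left_mono)
    qed (use that \<epsilon> in auto)
    then show ?thesis by (simp add: \<Gamma>0)
  qed
  let ?g = "\<lambda>s. vector_derivative \<gamma> (at s)"
  \<comment> \<open>The difference quotient of the integrand supplied by the exact difference formula.\<close>
  let ?q = "\<lambda>t s. cross3 ((\<Gamma> t s - \<gamma> s) /\<^sub>R t) (?g s + D (0, 1) (t, s)) \<bullet> v"
  have Eq: "(E_minus_1 I v (\<Gamma> t) - E_minus_1 I v \<gamma>) / t = 1/2 * integral I (?q t)" if "t \<in> {-\<epsilon><..<\<epsilon>}" for t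
  proof -
    have "integral I (?q t) = integral I (\<lambda>s. inverse t *
        (cross3 (\<Gamma> t s - \<gamma> s) (?g s + vector_derivative (\<Gamma> t) (at s)) \<bullet> v))"
      by (intro integral_cong) (simp only: ds[OF that] cross_mult_left inner_scaleR_left)
    then show ?thesis
      unfolding E_difference[OF \<gamma> cu[OF that]] Henstock_Kurzweil_Integration.integral_mult_right
      by (simp only: divide_inverse mult.assoc mult.commute mult.left_commute)
  qed
  have g0: "D (0, 1) (0, s) = ?g s" for s using ds[of 0 s] \<epsilon> by (simp add: \<Gamma>0)
  have "((\<lambda>t. 1/2 * integral I (?q t)) \<longlongrightarrow> 1/2 * integral I (\<lambda>s. cross3 (\<xi> s) (?g s + ?g s) \<bullet> v))
     (at 0 within {-\<epsilon>/2<..<\<epsilon>/2})"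
  proof (rule tendsto_mult[OF tendsto_const], unfold tendsto_at_iff_sequentially o_def, intro allI impI)
    fix X :: "nat \<Rightarrow> real" assume X: "\<forall>i. X i \<in> {-\<epsilon>/2<..<\<epsilon>/2} - {0}" and X0: "X \<longlonglongrightarrow> 0"
    have XJ: "X i \<in> ?J" "X i \<noteq> 0" for i
      using X by (auto simp: less_imp_le)
    have XS: "X i \<in> {-\<epsilon><..<\<epsilon>}" for i
      using XJ(1) J by blast
    show "(\<lambda>i. integral I (?q (X i))) \<longlonglongrightarrow> integral I (\<lambda>s. cross3 (\<xi> s) (?g s + ?g s) \<bullet> v)"
    proof (rule dominated_convergence(2)[where h = "\<lambda>_. K * (L + L) * norm v"])
      show "?q (X i) integrable_on I" for i
      proof (rule integrable_I)
        have "continuous_on I (\<lambda>s. D (0, 1) (X i, s))"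
          by (rule continuous_on_compose2[OF cD]) (use XS in \<open>auto intro!: continuous_intros\<close>)
        then show "continuous_on I (?q (X i))"
          by (intro continuous_intros continuous_on_cross curve_continuous[OF \<gamma>]
              curve_continuous[OF cu] curve_deriv_continuous[OF \<gamma>] XS XJ)
      qed
      show "(\<lambda>_. K * (L + L) * norm v) integrable_on I"
        by (rule integrable_I) (rule continuous_on_const)
    next
      fix i s assume s: "s \<in> I"
      have 0: "0 \<in> ?J" using \<epsilon> by auto
      have "norm ((\<Gamma> (X i) s - \<gamma> s) /\<^sub>R X i) \<le> K"
      proof -
        have "norm ((\<Gamma> (X i) s - \<gamma> s) /\<^sub>R X i) = norm (\<Gamma> (X i) s - \<gamma> s) / \<bar>X i\<bar>"
          by (simp only: norm_scaleR abs_inverse divide_inverse mult.commute)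
        then show ?thesis
          using lip[OF XJ(1) s, of i] XJ(2)[of i] by (simp only: pos_divide_le_eq zero_less_abs_iff not_False_eq_True)
      qed
      moreover have "norm (?g s + D (0, 1) (X i, s)) \<le> L + L"
        using L[OF 0 s] L[OF XJ(1) s, of i] by (intro norm_triangle_mono) (auto simp: g0)
      moreover have "norm (cross3 x y \<bullet> v) \<le> norm x * norm y * norm v" for x y
        using order_trans[OF Cauchy_Schwarz_ineq2 mult_right_mono[OF norm_cross3_le norm_ge_zero]] by simp
      moreover have "0 \<le> K" using K[OF 0 s] norm_ge_zero order_trans by blast
      ultimately show "norm (?q (X i) s) \<le> K * (L + L) * norm v"
        by (meson mult_mono mult_right_mono norm_ge_zero order_trans)
    next
      fix s assume "s \<in> I"
      have "((\<lambda>t. (\<Gamma> t s - \<gamma> s) /\<^sub>R t) \<longlongrightarrow> \<xi> s) (at 0)"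
        using has_vector_derivative_quotient[OF var[of s]] by (simp only: \<Gamma>0)
      then have 1: "(\<lambda>i. (\<Gamma> (X i) s - \<gamma> s) /\<^sub>R X i) \<longlonglongrightarrow> \<xi> s"
        using X0 XJ by (auto simp: tendsto_at_iff_sequentially o_def)
      have "(\<lambda>i. D (0, 1) (X i, s)) \<longlonglongrightarrow> D (0, 1) (0, s)"
        by (rule continuous_on_tendsto_compose[OF cD]) (use XS \<epsilon> X0 in \<open>auto intro!: tendsto_intros\<close>)
      then show "(\<lambda>i. ?q (X i) s) \<longlonglongrightarrow> cross3 (\<xi> s) (?g s + ?g s) \<bullet> v"
        unfolding g0
        by (intro tendsto_intros bounded_bilinear.tendsto[OF bounded_bilinear_cross3] 1)
    qed
  qed
  moreover have "at 0 within {-\<epsilon>/2<..<\<epsilon>/2} = at (0::real)"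
    using \<epsilon> by (intro at_within_open) auto
  moreover have "1/2 * integral I (\<lambda>s. cross3 (\<xi> s) (?g s + ?g s) \<bullet> v) = L2_metric I \<gamma> (\<lambda>s. cross3 (unit_tangent \<gamma> s) v) \<xi>"
  proof -
    have "(\<lambda>s. cross3 (\<xi> s) (?g s + ?g s) \<bullet> v) = (\<lambda>s. 2 * (cross3 (\<xi> s) (?g s) \<bullet> v))"
      by (simp only: cross_add_right inner_add_left mult_2)
    then show ?thesis by (simp add: L2_unit_tangent_cross[OF \<gamma>])
  qed
  moreover have "\<forall>\<^sub>F t in at 0. (E_minus_1 I v (\<Gamma> t) - E_minus_1 I v \<gamma>) / t = 1/2 * integral I (?q t)"
  proof (rule eventually_mono)
    show "\<forall>\<^sub>F t in at 0. t \<in> {-\<epsilon><..<\<epsilon>}"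
      using \<epsilon> by (intro eventually_at_in_open') auto
  qed (rule Eq)
  ultimately have "((\<lambda>t. (E_minus_1 I v (\<Gamma> t) - E_minus_1 I v \<gamma>) / t) \<longlongrightarrow>
      L2_metric I \<gamma> (\<lambda>s. cross3 (unit_tangent \<gamma> s) v) \<xi>) (at 0)"
    by (simp only: tendsto_cong)
  then show "((\<lambda>t. E_minus_1 I v (\<Gamma> t)) has_real_derivative
      L2_metric I \<gamma> (\<lambda>s. cross3 (unit_tangent \<gamma> s) v) \<xi>) (at 0)"
    by (simp add: DERIV_def \<Gamma>0)
qed


section \<open>Uniqueness of gradients\<close>

text \<open>Being immersed is preserved for small \<open>t\<close> on the compact fundamental domain, where \<open>\<bar>\<gamma>'\<bar>\<close> has a
  positive minimum \<open>m\<close> and \<open>\<bar>\<xi>'\<bar>\<close> a bound \<open>K\<close>; equivariance spreads this over the line.\<close>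

lemma affine_variation:
  assumes \<gamma>: "\<gamma> \<in> curves \<tau> A a" and \<xi>: "\<xi> \<in> tangent_space \<tau> A"
  shows "variation \<tau> A a \<gamma> \<xi> (\<lambda>t s. \<gamma> s + t *\<^sub>R \<xi> s)"
proof -
  let ?g = "\<lambda>s. vector_derivative \<gamma> (at s)" and ?x = "\<lambda>s. vector_derivative \<xi> (at s)"
  note sx = tangent_smooth[OF \<xi>]
  have sm: "smooth_on UNIV (\<lambda>p :: real \<times> real. \<gamma> (snd p) + fst p *\<^sub>R \<xi> (snd p))"
    by (intro smooth_intros smooth_on_bounded_linear[OF bounded_linear_fst]
        smooth_on_compose_linear[OF bounded_linear_snd curve_smooth[OF \<gamma>]]
        smooth_on_compose_linear[OF bounded_linear_snd sx])
  have smt: "smooth_on UNIV (\<lambda>s. \<gamma> s + t *\<^sub>R \<xi> s)" for t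
    by (intro smooth_intros curve_smooth[OF \<gamma>] sx)
  have dt: "vector_derivative (\<lambda>s. \<gamma> s + t *\<^sub>R \<xi> s) (at s) = ?g s + t *\<^sub>R ?x s" for t s
    by (intro vector_derivative_at has_vector_derivative_add curve_deriv[OF \<gamma>]
        bounded_linear.has_vector_derivative[OF bounded_linear_scaleR_right]
        smooth_on_has_vector_derivative[OF sx])
  have tau: "\<gamma> (\<tau> s) + t *\<^sub>R \<xi> (\<tau> s) = A *v (\<gamma> s + t *\<^sub>R \<xi> s) + a" for t s
    by (simp add: curve_tau[OF \<gamma>] tangent_tau[OF \<xi>] matrix_vector_right_distrib matrix_vector_mult_scaleR)
  have cI: "compact I" using fd_compact by force
  have neI: "I \<noteq> {}" using fundamental_domain_cases[OF fd] by force
  obtain s0 where s0: "\<And>s. s \<in> I \<Longrightarrow> norm (?g s0) \<le> norm (?g s)"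
    using continuous_attains_inf[OF cI neI, of "\<lambda>s. norm (?g s)"] curve_deriv_continuous[OF \<gamma>]
    by (metis continuous_on_norm)
  define m where "m = norm (?g s0)"
  have m: "m > 0" using curve_immersed[OF \<gamma>] by (simp add: m_def)
  have "compact (?x ` I)"
    by (intro compact_continuous_image cI smooth_on_continuous_on smooth_on_vector_derivative sx)
  then obtain K where K: "K > 0" "\<And>s. s \<in> I \<Longrightarrow> norm (?x s) \<le> K"
    by (force dest: compact_imp_bounded simp: bounded_pos)
  have cu: "(\<lambda>s. \<gamma> s + t *\<^sub>R \<xi> s) \<in> curves \<tau> A a" if t: "t \<in> {-(m/K)<..<m/K}" for t
  proof -
    let ?d = "\<lambda>s. ?g s + t *\<^sub>R ?x s"
    have "?d s \<noteq> 0" for s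
    proof (rule invariant_property_everywhere[OF fd, of "\<lambda>s. ?d s \<noteq> 0"])
      fix s
      have "dtau s *\<^sub>R ?d (\<tau> s) = A *v ?d s"
        using equivariant_derivative[OF smt tau, of s t] by (simp only: dt)
      moreover have "dtau s *\<^sub>R ?d (\<tau> s) = 0 \<longleftrightarrow> ?d (\<tau> s) = 0" using dtau_pos[of s] by simp
      moreover have "A *v ?d s = 0 \<longleftrightarrow> ?d s = 0" using A_norm[of "?d s"] by (metis norm_eq_zero)
      ultimately show "?d (\<tau> s) \<noteq> 0 \<longleftrightarrow> ?d s \<noteq> 0" by simp
    next
      fix s assume s: "s \<in> I"
      have "norm (t *\<^sub>R ?x s) \<le> \<bar>t\<bar> * K" using K(2)[OF s] by (simp add: mult_left_mono)
      also have "\<dots> < m" using t K(1) by (simp add: abs_less_iff flip: pos_less_divide_eq)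
      also have "m \<le> norm (?g s)" using s0[OF s] by (simp add: m_def)
      finally show "?d s \<noteq> 0" by (metis add_eq_0_iff norm_minus_cancel less_irrefl)
    qed
    then show ?thesis using smt tau by (simp add: curves_def dt monodromy_def)
  qed
  have var: "((\<lambda>t. \<gamma> s + t *\<^sub>R \<xi> s) has_vector_derivative \<xi> s) (at 0)" for s
    by (auto intro!: derivative_eq_intros)
  show ?thesis unfolding variation_def
  proof (intro conjI exI[of _ "m/K"] ballI allI)
    show "smooth_on ({-(m/K)<..<m/K} \<times> UNIV) (\<lambda>(t, s). \<gamma> s + t *\<^sub>R \<xi> s)"
      using smooth_on_subset[OF sm] by (simp add: case_prod_unfold)
  qed (use m K cu var in auto)
qed

text \<open>A nonnegative continuous integrand with vanishing integral is zero on the fundamental domain, and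
  equivariance carries the zeros of \<open>\<xi>\<close> to the whole line.\<close>

lemma L2_nondegenerate:
  assumes \<gamma>: "\<gamma> \<in> curves \<tau> A a" and \<xi>: "\<xi> \<in> tangent_space \<tau> A" and 0: "L2_metric I \<gamma> \<xi> \<xi> = 0"
  shows "\<xi> s = 0"
proof (rule invariant_property_everywhere[OF fd])
  show "\<xi> (\<tau> s) = 0 \<longleftrightarrow> \<xi> s = 0" for s
    using A_norm[of "\<xi> s"] by (simp add: tangent_tau[OF \<xi>]) (metis norm_eq_zero)
next
  fix s assume s: "s \<in> I"
  obtain lo hi where lh: "lo < hi" "I = {lo..hi}"
    using fundamental_domain_cases[OF fd] by blast
  let ?f = "\<lambda>s. \<xi> s \<bullet> \<xi> s * speed \<gamma> s"
  have "continuous_on {lo..hi} ?f"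
    by (intro continuous_intros smooth_on_continuous_on[OF tangent_smooth[OF \<xi>]] speed_continuous[OF \<gamma>])
  then have "integral {lo..hi} ?f = 0 \<longleftrightarrow> (\<forall>s\<in>{lo..hi}. ?f s = 0)"
    using lh speed_pos[OF \<gamma>] by (intro integral_eq_0_iff) (auto intro!: mult_nonneg_nonneg simp: less_imp_le)
  then have "?f s = 0" using 0 s lh by (simp add: L2_metric_def)
  then show "\<xi> s = 0" using speed_pos[OF \<gamma>, of s] by simp
qed

text \<open>The difference of two representing tangent vectors is itself a tangent vector, so it can serve
  as its own test direction.\<close>

lemma differential_eq_L2_iff:
  assumes \<gamma>: "\<gamma> \<in> curves \<tau> A a" and Z: "Z \<in> tangent_space \<tau> A"
  shows "has_differential \<tau> A a (E_minus_1 I v) \<gamma> (L2_metric I \<gamma> Z)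
    \<longleftrightarrow> Z = (\<lambda>s. cross3 (unit_tangent \<gamma> s) v)"
proof
  assume h: "has_differential \<tau> A a (E_minus_1 I v) \<gamma> (L2_metric I \<gamma> Z)"
  let ?G = "\<lambda>s. cross3 (unit_tangent \<gamma> s) v"
  have G: "?G \<in> tangent_space \<tau> A" by (intro cross_in unit_tangent_in \<gamma> const_in)
  let ?X = "\<lambda>s. Z s - ?G s"
  have X: "?X \<in> tangent_space \<tau> A" by (intro diff_in Z G)
  \<comment> \<open>Both sides are the derivative of the functional along the same affine variation.\<close>
  have eq: "L2_metric I \<gamma> Z ?X = L2_metric I \<gamma> ?G ?X"
    using h differential_E[OF \<gamma>] X affine_variation[OF \<gamma> X] DERIV_unique
    unfolding has_differential_def by blast
  have "L2_metric I \<gamma> ?X ?X = L2_metric I \<gamma> Z ?X - L2_metric I \<gamma> ?G ?X"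
  proof -
    have "(\<lambda>s. W s \<bullet> ?X s * speed \<gamma> s) integrable_on I" if "W \<in> tangent_space \<tau> A" for W
      by (intro integrable_I continuous_intros speed_continuous[OF \<gamma>]
          smooth_on_continuous_on[OF tangent_smooth[OF that]] smooth_on_continuous_on[OF tangent_smooth[OF X]])
    then show ?thesis using Z G unfolding L2_metric_def
      by (subst Henstock_Kurzweil_Integration.integral_diff[symmetric])
         (auto simp: inner_diff_left Rings.left_diff_distrib)
  qed
  then have "L2_metric I \<gamma> ?X ?X = 0" by (simp only: eq diff_self)
  from L2_nondegenerate[OF \<gamma> X this] show "Z = ?G"
    by (rule ext[OF eq_iff_diff_eq_0[THEN iffD2]])
qed (simp add: differential_E[OF \<gamma>])

text \<open>If \<open>T \<times> (Y - v) = 0\<close>, the Lagrange identity gives \<open>Y - v = (T, Y - v) T\<close>, and the coefficient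
  inherits smoothness and invariance from \<open>T\<close>, \<open>Y\<close> and \<open>v\<close>.\<close>

lemma cong_iff_cross_eq:
  assumes \<gamma>: "\<gamma> \<in> curves \<tau> A a"
  shows "(Y \<in> tangent_space \<tau> A \<and> (\<lambda>s. cross3 (unit_tangent \<gamma> s) (Y s)) = (\<lambda>s. cross3 (unit_tangent \<gamma> s) v))
    \<longleftrightarrow> (\<exists>f :: real \<Rightarrow> real. smooth_on UNIV f \<and> (\<forall>s. f (\<tau> s) = f s) \<and>
       (\<forall>s. Y s = v + f s *\<^sub>R unit_tangent \<gamma> s))"
proof
  let ?T = "unit_tangent \<gamma>"
  assume "Y \<in> tangent_space \<tau> A \<and> (\<lambda>s. cross3 (?T s) (Y s)) = (\<lambda>s. cross3 (?T s) v)"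
  then have Y: "Y \<in> tangent_space \<tau> A" and eq: "\<And>s. cross3 (?T s) (Y s) = cross3 (?T s) v"
    by (auto simp: fun_eq_iff)
  define f where "f = (\<lambda>s. ?T s \<bullet> (Y s - v))"
  have "smooth_on UNIV f" unfolding f_def
    by (intro smooth_intros unit_tangent_smooth[OF \<gamma>] tangent_smooth[OF Y])
  moreover have "f (\<tau> s) = f s" for s
  proof -
    have "f (\<tau> s) = (A *v ?T s) \<bullet> (A *v Y s - A *v v)"
      by (simp add: f_def unit_tangent_tau[OF \<gamma>] tangent_tau[OF Y] v)
    then show ?thesis by (simp add: f_def A_inner flip: matrix_vector_mult_diff_distrib)
  qed
  moreover have "Y s = v + f s *\<^sub>R ?T s" for s
  proof -
    have "0 = cross3 (?T s) (cross3 (?T s) (Y s - v))"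
      by (simp add: Cross3.right_diff_distrib eq)
    also have "\<dots> = f s *\<^sub>R ?T s - (Y s - v)"
      by (simp add: Lagrange unit_tangent_norm[OF \<gamma>] f_def)
    finally show ?thesis by (simp add: algebra_simps)
  qed
  ultimately show "\<exists>f :: real \<Rightarrow> real. smooth_on UNIV f \<and> (\<forall>s. f (\<tau> s) = f s) \<and>
       (\<forall>s. Y s = v + f s *\<^sub>R ?T s)" by blast
next
  let ?T = "unit_tangent \<gamma>"
  assume "\<exists>f :: real \<Rightarrow> real. smooth_on UNIV f \<and> (\<forall>s. f (\<tau> s) = f s) \<and>
       (\<forall>s. Y s = v + f s *\<^sub>R ?T s)"
  then obtain f :: "real \<Rightarrow> real" where f: "smooth_on UNIV f" "\<And>s. f (\<tau> s) = f s"
    and Y: "Y = (\<lambda>s. v + f s *\<^sub>R ?T s)" by (auto simp: fun_eq_iff)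
  have "smooth_on UNIV Y" unfolding Y by (intro smooth_intros f unit_tangent_smooth[OF \<gamma>])
  then show "Y \<in> tangent_space \<tau> A \<and> (\<lambda>s. cross3 (?T s) (Y s)) = (\<lambda>s. cross3 (?T s) v)"
    by (simp add: tangent_space_def Y f unit_tangent_tau[OF \<gamma>] v matrix_vector_right_distrib
        matrix_vector_mult_scaleR cross_add_right cross_mult_right)
qed

lemma variational_gradient_iff:
  "variational_gradient \<tau> I A a (E_minus_1 I v) G \<longleftrightarrow>
    (\<forall>\<gamma>\<in>curves \<tau> A a. G \<gamma> = (\<lambda>s. cross3 (unit_tangent \<gamma> s) v))"
proof -
  have "G \<gamma> \<in> tangent_space \<tau> A \<and> has_differential \<tau> A a (E_minus_1 I v) \<gamma> (L2_metric I \<gamma> (G \<gamma>))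
    \<longleftrightarrow> G \<gamma> = (\<lambda>s. cross3 (unit_tangent \<gamma> s) v)" if "\<gamma> \<in> curves \<tau> A a" for \<gamma>
    using differential_eq_L2_iff[OF that, of "G \<gamma>"] cross_in[OF unit_tangent_in[OF that] const_in] by auto
  then show ?thesis unfolding variational_gradient_def by simp
qed

lemma symplectic_gradient_iff:
  "symplectic_gradient \<tau> I A a (E_minus_1 I v) Y \<longleftrightarrow> cong_mod_tangent \<tau> A a Y (\<lambda>\<gamma> s. v)"
proof -
  have "Y \<gamma> \<in> tangent_space \<tau> A \<and> has_differential \<tau> A a (E_minus_1 I v) \<gamma> (presymplectic I \<gamma> (Y \<gamma>))
    \<longleftrightarrow> Y \<gamma> \<in> tangent_space \<tau> A \<and>
        (\<lambda>s. cross3 (unit_tangent \<gamma> s) (Y \<gamma> s)) = (\<lambda>s. cross3 (unit_tangent \<gamma> s) v)"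
    if "\<gamma> \<in> curves \<tau> A a" for \<gamma>
    using differential_eq_L2_iff[OF that cross_in[OF unit_tangent_in[OF that]]]
    by (auto simp: presymplectic_eq_L2)
  then show ?thesis
    unfolding symplectic_gradient_def cong_mod_tangent_def by (simp add: cong_iff_cross_eq)
qed


section \<open>The flux primitive and the projected area\<close>

lemma volume_preserving_const: "volume_preserving_field (\<lambda>p. v)"
  by (simp add: volume_preserving_field_def smooth_on_const Let_def det_3 vector_def)

lemma translation_primitive_eq: "translation_primitive v p X = 1/2 * (cross3 p X \<bullet> v)"
  by (simp add: translation_primitive_def inner_commute[of _ v] dot_cross_det)

lemma invariant_translation_primitive:
  "invariant_primitive (monodromy A a) (\<lambda>p. v) (translation_primitive v)"
proof -
  have lin1: "bounded_linear (\<lambda>p. translation_primitive v p X)"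
    and lin2: "bounded_linear (translation_primitive v X)" for X
    by (intro linear_conv_bounded_linear[THEN iffD1] linearI;
        simp add: translation_primitive_eq cross_add_left cross_add_right cross_mult_left cross_mult_right
          inner_add_left algebra_simps)+
  have fd: "frechet_derivative (\<lambda>p. translation_primitive v p X) (at p) = (\<lambda>p. translation_primitive v p X)" for X p
    using frechet_derivative_at[OF bounded_linear_imp_has_derivative[OF lin1]] by metis
  have fm: "frechet_derivative (monodromy A a) (at p) = (\<lambda>X. A *v X)" for p
  proof -
    have "(monodromy A a has_derivative (\<lambda>x. A *v x)) (at p)"
      unfolding monodromy_def[abs_def]
      by (rule has_derivative_add_const) (simp add: bounded_linear_imp_has_derivative)
    then show ?thesis using frechet_derivative_at by metis
  qed
  have "translation_primitive v (A *v p + a) (A *v X) = translation_primitive v p X" for p X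
  proof -
    have "cross3 (A *v p + a) (A *v X) \<bullet> v = (A *v cross3 p X) \<bullet> (A *v v)"
      by (simp add: cross_add_left inner_add_left a_cross_v A_cross v)
    then show ?thesis by (simp only: translation_primitive_eq A_inner)
  qed
  moreover have "ext_derivative (translation_primitive v) p X Y = det (vector [v, X, Y])" for p X Y
    unfolding ext_derivative_def fd by (simp add: translation_primitive_def det_3 field_simps)
  ultimately show ?thesis
    unfolding invariant_primitive_def smooth_one_form_def pullback_def fun_eq_iff fm
    using lin1 lin2 by (simp add: smooth_on_bounded_linear bounded_linear.linear monodromy_def)
qed

lemma flux_eq: "flux I (translation_primitive v) \<gamma> = E_minus_1 I v \<gamma>"
  by (simp add: flux_def E_minus_1_def translation_primitive_eq)

text \<open>Since \<open>v = e1 \<times> e2\<close>, the Binet-Cauchy identity turns \<open>(\<gamma> \<times> \<gamma>', v)\<close> into the area integrand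
  of the projection in the coordinates given by \<open>e1\<close> and \<open>e2\<close>.\<close>

lemma projected_path_area:
  assumes \<gamma>: "\<gamma> \<in> curves \<tau> A a" and closed: "\<And>s. \<gamma> (\<tau> s) = \<gamma> s" and e: "oriented_basis v e1 e2"
  shows "pathfinish (projected_path I v e1 e2 \<gamma>) = pathstart (projected_path I v e1 e2 \<gamma>)"
    and "has_signed_area (projected_path I v e1 e2 \<gamma>) (E_minus_1 I v \<gamma>)"
proof -
  obtain lo hi where lh: "lo < hi" "I = {lo..hi}" "hi = \<tau> lo \<or> lo = \<tau> hi"
    using fundamental_domain_cases[OF fd] .
  have ends: "\<gamma> lo = \<gamma> hi" using lh closed by auto
  have ve: "v = cross3 e1 e2" using e by (simp add: oriented_basis_def)
  let ?l = "\<lambda>t. lo + t * (hi - lo)"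
  let ?g = "\<lambda>s. vector_derivative \<gamma> (at s)"
  let ?P = "\<lambda>p. Complex (p \<bullet> e1) (p \<bullet> e2)"
  define c where "c = (\<lambda>t. ?P (\<gamma> (?l t)))"
  define c' where "c' = (\<lambda>t. ?P ((hi - lo) *\<^sub>R ?g (?l t)))"
  have "linepath lo hi t = ?l t" for t by (simp add: linepath_def algebra_simps)
  then have path: "projected_path I v e1 e2 \<gamma> = c"
    using lh by (simp add: projected_path_def c_def fun_eq_iff orth_projection_def inner_diff_left ve dot_cross_self)
  have linP: "bounded_linear ?P"
    by (intro linear_conv_bounded_linear[THEN iffD1] linearI) (simp_all add: complex_eq_iff inner_add_left)
  interpret C1_loop c c'
  proof
    fix t
    have "(?l has_real_derivative (hi - lo)) (at t)" by (auto intro!: derivative_eq_intros)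
    then have "((\<lambda>t. \<gamma> (?l t)) has_vector_derivative (hi - lo) *\<^sub>R ?g (?l t)) (at t)"
      using vector_diff_chain_at[OF _ curve_deriv[OF \<gamma>], of ?l "hi - lo" t]
      by (simp add: has_real_derivative_iff_has_vector_derivative o_def)
    then show "(c has_vector_derivative c' t) (at t)"
      unfolding c_def c'_def by (rule bounded_linear.has_vector_derivative[OF linP])
  next
    show "continuous_on UNIV c'" unfolding c'_def
      by (intro bounded_linear.continuous_on[OF linP] continuous_intros
          continuous_on_compose2[OF curve_deriv_continuous[OF \<gamma>, of UNIV]]) auto
  qed (simp add: c_def ends)
  show "pathfinish (projected_path I v e1 e2 \<gamma>) = pathstart (projected_path I v e1 e2 \<gamma>)"
    by (simp add: path pathfinish_def pathstart_def C1_loop.closed[OF C1_loop_axioms])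
  let ?f = "\<lambda>s. cross3 (\<gamma> s) (?g s) \<bullet> v"
  have integrand: "Re (c t) * Im (c' t) - Im (c t) * Re (c' t) = (hi - lo) *\<^sub>R ?f (?l t)" for t
    by (simp add: c_def c'_def ve dot_cross algebra_simps)
  have "((\<lambda>t. (hi - lo) *\<^sub>R ?f (?l t)) has_integral integral {?l 0..?l 1} ?f) {0..1}"
  proof (rule has_integral_substitution[where c = lo and d = hi])
    show "?l ` {0..1} \<subseteq> {lo..hi}"
    proof safe
      fix t :: real assume "t \<in> {0..1}"
      then have "0 \<le> t * (hi - lo)" "t * (hi - lo) \<le> hi - lo"
        using lh by (auto intro: mult_left_le_one_le)
      then show "?l t \<in> {lo..hi}" by simp
    qed
    show "continuous_on {lo..hi} ?f"
      by (intro continuous_intros continuous_on_cross curve_continuous[OF \<gamma>] curve_deriv_continuous[OF \<gamma>])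
  qed (use lh in \<open>auto intro!: derivative_eq_intros\<close>)
  from integral_unique[OF this]
  have "integral {0..1} (\<lambda>t. Re (c t) * Im (c' t) - Im (c t) * Re (c' t)) = integral {?l 0..?l 1} ?f"
    by (simp only: integrand)
  then have "integral {0..1} (\<lambda>t. Re (c t) * Im (c' t) - Im (c t) * Re (c' t)) = integral I ?f"
    using lh by simp
  then show "has_signed_area (projected_path I v e1 e2 \<gamma>) (E_minus_1 I v \<gamma>)"
    using signed_area by (simp add: path E_minus_1_def)
qed

end

theorem theorem5:
  fixes \<tau> :: "real \<Rightarrow> real" and I :: "real set"
    and A :: "real^3^3" and a v :: "real^3"
  assumes "translation_diffeo \<tau>" and "fundamental_domain \<tau> I"
    and "rotation_matrix A" and "norm v = 1" and "A *v v = v" and "a \<in> span {v}"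
  shows
    "volume_preserving_field (\<lambda>p. v) \<and>
     invariant_primitive (monodromy A a) (\<lambda>p. v) (translation_primitive v) \<and>
     (\<forall>\<gamma>\<in>curves \<tau> A a. flux I (translation_primitive v) \<gamma> = E_minus_1 I v \<gamma>) \<and>
     (\<forall>\<gamma>\<in>curves \<tau> A a. (\<forall>s. \<gamma> (\<tau> s) = \<gamma> s) \<longrightarrow>
        (\<forall>e1 e2. oriented_basis v e1 e2 \<longrightarrow>
           pathfinish (projected_path I v e1 e2 \<gamma>) = pathstart (projected_path I v e1 e2 \<gamma>) \<and>
           has_signed_area (projected_path I v e1 e2 \<gamma>) (E_minus_1 I v \<gamma>))) \<and>
     (\<forall>G. variational_gradient \<tau> I A a (E_minus_1 I v) G \<longleftrightarrow>
        (\<forall>\<gamma>\<in>curves \<tau> A a. G \<gamma> = (\<lambda>s. cross3 (arclength_derivative \<gamma> \<gamma> s) v))) \<and>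
     (\<forall>Y. symplectic_gradient \<tau> I A a (E_minus_1 I v) Y \<longleftrightarrow>
        cong_mod_tangent \<tau> A a Y (\<lambda>\<gamma> s. v))"
proof -
  interpret monodromy_setting \<tau> I A a v
    using assms by unfold_locales
  have "\<forall>\<gamma>\<in>curves \<tau> A a. (\<forall>s. \<gamma> (\<tau> s) = \<gamma> s) \<longrightarrow>
      (\<forall>e1 e2. oriented_basis v e1 e2 \<longrightarrow>
         pathfinish (projected_path I v e1 e2 \<gamma>) = pathstart (projected_path I v e1 e2 \<gamma>) \<and>
         has_signed_area (projected_path I v e1 e2 \<gamma>) (E_minus_1 I v \<gamma>))"
    using projected_path_area by metis
  then show ?thesis
    by (simp only: flux_eq variational_gradient_iff symplectic_gradient_iff unit_tangent_def
        volume_preserving_const invariant_translation_primitive ball_triv simp_thms)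
qed

end
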